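(* Let $R$ be an arbitrary associative unitary ring, let $L:\mathrm{Mod}(R)\to \mathbb{R}_{\geq 0}\cup\{\infty\}$ be a length function, let $M_\phi\in\mathrm{lFin}_L[X]$ and let $N_\psi=M_\phi\otimes_{R[X]}R[X^{\pm1}]$. Then $\mathrm{ent}_L(\phi)=\mathrm{ent}_L(\psi)$.
   Context: $\mathrm{Mod}(R)$ is the category of right $R$-modules. A function $L:\mathrm{Mod}(R)\to \mathbb{R}_{\geq 0}\cup\{\infty\}$ is a length function if: $L(0)=0$ and $L(M)=L(M')$ whenever $M\cong M'$; $L(M)=L(M')+L(M'')$ for every short exact sequence $0\to M'\to M\to M''\to 0$ (additive); and $L(M)=\sup\{L(F): F \text{ a finitely generated submodule of } M\}$ for all $M$ (upper continuous). A module $N$ is $L$-finite if $L(N)<\infty$; $\mathrm{Fin}_L(M)$ is the set of $L$-finite submodules of $M$. A module is locally $L$-finite if all its finitely generated submodules are $L$-finite. $M_\phi$, with $M$ a right $R$-module and $\phi\in\mathrm{End}_R(M)$, denotes the right $R[X]$-module with underlying $R$-module $M$ on which $X$ acts as $\phi$. $\mathrm{lFin}_L[X]$ is the class of those $M_\phi$ with $M$ locally $L$-finite as an $R$-module. $R[X^{\pm1}]$ is the ring of Laurent polynomials over $R$; $N_\psi=M_\phi\otimes_{R[X]}R[X^{\pm1}]$ means that $N$ is the underlying right $R$-module of the tensor product and $\psi$ is the action of $X$ on it. For $N\in\mathrm{Fin}_L(M)$ and $n\geq 1$ let $T_n(\phi,N)=\sum_{i=0}^{n-1}\phi^i(N)$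 and $\mathrm{ent}_L(\phi,N)=\lim_{n\to\infty}L(T_n(\phi,N))/n$ (the limit exists and is finite). The algebraic $L$-entropy is $\mathrm{ent}_L(M_\phi)=\mathrm{ent}_L(\phi)=\sup\{\mathrm{ent}_L(\phi,N): N\in\mathrm{Fin}_L(M)\}$. *)

theory Defs
  imports "HOL-Algebra.Algebra" "HOL-Algebra.Free_Abelian_Groups"
    "HOL-Library.Extended_Nonnegative_Real"
begin

section \<open>Right modules over an arbitrary unitary ring\<close>

text \<open>
  The locale \<^locale>\<open>module\<close> of the library is about left modules over commutative rings.
  As there, the record extends \<^typ>\<open>'b ring\<close>, whose fields for a multiplication and a unit are
  not used.
\<close>

record ('a, 'b) rmod = "'b ring" +
  ract :: "['b, 'a] \<Rightarrow> 'b"  (infixl \<open>\<lhd>\<index>\<close> 70)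

locale right_module = R?: ring R + M?: abelian_group M
  for R :: "('a, 'k) ring_scheme" (structure) and M :: "('a, 'b, 'l) rmod_scheme" (structure) +
  assumes ract_closed:
      "\<lbrakk> x \<in> carrier M; r \<in> carrier R \<rbrakk> \<Longrightarrow> x \<lhd>\<^bsub>M\<^esub> r \<in> carrier M"
    and ract_add_left:
      "\<lbrakk> x \<in> carrier M; y \<in> carrier M; r \<in> carrier R \<rbrakk>
        \<Longrightarrow> (x \<oplus>\<^bsub>M\<^esub> y) \<lhd>\<^bsub>M\<^esub> r = (x \<lhd>\<^bsub>M\<^esub> r) \<oplus>\<^bsub>M\<^esub> (y \<lhd>\<^bsub>M\<^esub> r)"
    and ract_add_right:
      "\<lbrakk> x \<in> carrier M; r \<in> carrier R; s \<in> carrier R \<rbrakk>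
        \<Longrightarrow> x \<lhd>\<^bsub>M\<^esub> (r \<oplus>\<^bsub>R\<^esub> s) = (x \<lhd>\<^bsub>M\<^esub> r) \<oplus>\<^bsub>M\<^esub> (x \<lhd>\<^bsub>M\<^esub> s)"
    and ract_assoc:
      "\<lbrakk> x \<in> carrier M; r \<in> carrier R; s \<in> carrier R \<rbrakk>
        \<Longrightarrow> x \<lhd>\<^bsub>M\<^esub> (r \<otimes>\<^bsub>R\<^esub> s) = (x \<lhd>\<^bsub>M\<^esub> r) \<lhd>\<^bsub>M\<^esub> s"
    and ract_one: "x \<in> carrier M \<Longrightarrow> x \<lhd>\<^bsub>M\<^esub> \<one>\<^bsub>R\<^esub> = x"

definition rmod_hom ::
  "('a, 'k) ring_scheme \<Rightarrow> ('a, 'b, 'l) rmod_scheme \<Rightarrow> ('a, 'c, 'm) rmod_scheme \<Rightarrow> ('b \<Rightarrow> 'c) set"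
  where "rmod_hom R M N =
    {f \<in> hom (add_monoid M) (add_monoid N).
       \<forall>x \<in> carrier M. \<forall>r \<in> carrier R. f (x \<lhd>\<^bsub>M\<^esub> r) = f x \<lhd>\<^bsub>N\<^esub> r}"

definition rmod_isomorphic ::
  "('a, 'k) ring_scheme \<Rightarrow> ('a, 'b, 'l) rmod_scheme \<Rightarrow> ('a, 'c, 'm) rmod_scheme \<Rightarrow> bool"
  where "rmod_isomorphic R M N \<longleftrightarrow>
    (\<exists>f \<in> rmod_hom R M N. bij_betw f (carrier M) (carrier N))"

definition rsubmodule ::
  "('a, 'k) ring_scheme \<Rightarrow> 'b set \<Rightarrow> ('a, 'b, 'l) rmod_scheme \<Rightarrow> bool"
  where "rsubmodule R H M \<longleftrightarrow>
    subgroup H (add_monoid M) \<and> (\<forall>x \<in> H. \<forall>r \<in> carrier R. x \<lhd>\<^bsub>M\<^esub> r \<in> H)"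

definition rspan ::
  "('a, 'k) ring_scheme \<Rightarrow> ('a, 'b, 'l) rmod_scheme \<Rightarrow> 'b set \<Rightarrow> 'b set"
  where "rspan R M S = \<Inter> {H. rsubmodule R H M \<and> S \<subseteq> H}"

definition fg_rsubmodule ::
  "('a, 'k) ring_scheme \<Rightarrow> 'b set \<Rightarrow> ('a, 'b, 'l) rmod_scheme \<Rightarrow> bool"
  where "fg_rsubmodule R H M \<longleftrightarrow>
    (\<exists>S. finite S \<and> S \<subseteq> carrier M \<and> H = rspan R M S)"

definition short_exact ::
  "('a, 'k) ring_scheme \<Rightarrow> ('a, 'b, 'l) rmod_scheme \<Rightarrow> ('b \<Rightarrow> 'c) \<Rightarrow> ('a, 'c, 'm) rmod_scheme
    \<Rightarrow> ('c \<Rightarrow> 'd) \<Rightarrow> ('a, 'd, 'n) rmod_scheme \<Rightarrow> bool"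
  where "short_exact R A f B g C \<longleftrightarrow>
    right_module R A \<and> right_module R B \<and> right_module R C \<and>
    f \<in> rmod_hom R A B \<and> g \<in> rmod_hom R B C \<and>
    inj_on f (carrier A) \<and>
    f ` carrier A = {x \<in> carrier B. g x = \<zero>\<^bsub>C\<^esub>} \<and>
    g ` carrier B = carrier C"

definition restrict_scalars ::
  "('a \<Rightarrow> 'c) \<Rightarrow> ('c, 'b) rmod \<Rightarrow> ('a, 'b) rmod"
  where "restrict_scalars \<iota> M =
    \<lparr>carrier = carrier M, monoid.mult = monoid.mult M, one = one M,
     ring.zero = ring.zero M, ring.add = ring.add M,
     ract = (\<lambda>x r. x \<lhd>\<^bsub>M\<^esub> \<iota> r)\<rparr>"


section \<open>Length functions\<close>

text \<open>
  \<open>Mod(R)\<close> is rendered as the class of all right \<open>R\<close>-modules whose carrier is a subset of an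
  arbitrary type \<^typ>\<open>'u\<close>, which plays the role of the universe.
  Isomorphisms and short exact sequences are arbitrary ones between modules in \<^typ>\<open>'u\<close>;
  \<^typ>\<open>'u\<close> contains copies of all submodules and quotients of its modules. The values of \<open>L\<close> at
  records that are not right \<open>R\<close>-modules are irrelevant, and isomorphism invariance makes \<open>L\<close>
  independent of the unused record fields and of the operations outside the carrier.
\<close>

definition length_function ::
  "('a, 'k) ring_scheme \<Rightarrow> (('a, 'u) rmod \<Rightarrow> ennreal) \<Rightarrow> bool"
  where "length_function R L \<longleftrightarrow>
    (\<forall>M. right_module R M \<and> carrier M = {\<zero>\<^bsub>M\<^esub>} \<longrightarrow> L M = 0) \<and>
    (\<forall>M M'. right_module R M \<and> right_module R M' \<and> rmod_isomorphic R M M' \<longrightarrow> L M = L M') \<and>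
    (\<forall>M' f M g M''. short_exact R M' f M g M'' \<longrightarrow> L M = L M' + L M'') \<and>
    (\<forall>M. right_module R M \<longrightarrow>
       L M = (SUP F \<in> {F. fg_rsubmodule R F M}. L (M\<lparr>carrier := F\<rparr>)))"

definition Fin_L ::
  "('a, 'k) ring_scheme \<Rightarrow> (('a, 'u) rmod \<Rightarrow> ennreal) \<Rightarrow> ('a, 'u) rmod \<Rightarrow> 'u set set"
  where "Fin_L R L M = {N. rsubmodule R N M \<and> L (M\<lparr>carrier := N\<rparr>) < \<infinity>}"

definition locally_L_finite ::
  "('a, 'k) ring_scheme \<Rightarrow> (('a, 'u) rmod \<Rightarrow> ennreal) \<Rightarrow> ('a, 'u) rmod \<Rightarrow> bool"
  where "locally_L_finite R L M \<longleftrightarrow>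
    (\<forall>F. fg_rsubmodule R F M \<longrightarrow> L (M\<lparr>carrier := F\<rparr>) < \<infinity>)"


section \<open>Algebraic entropy\<close>

definition trajectory ::
  "('a, 'u) rmod \<Rightarrow> ('u \<Rightarrow> 'u) \<Rightarrow> 'u set \<Rightarrow> nat \<Rightarrow> 'u set"
  where "trajectory M \<phi> N n =
    {(\<Oplus>\<^bsub>M\<^esub> i \<in> {..<n}. x i) | x. \<forall>i < n. x i \<in> (\<phi> ^^ i) ` N}"

definition ent_at ::
  "(('a, 'u) rmod \<Rightarrow> ennreal) \<Rightarrow> ('a, 'u) rmod \<Rightarrow> ('u \<Rightarrow> 'u) \<Rightarrow> 'u set \<Rightarrow> ennreal"
  where "ent_at L M \<phi> N = lim (\<lambda>n. L (M\<lparr>carrier := trajectory M \<phi> N n\<rparr>) / of_nat n)"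

definition ent ::
  "('a, 'k) ring_scheme \<Rightarrow> (('a, 'u) rmod \<Rightarrow> ennreal) \<Rightarrow> ('a, 'u) rmod \<Rightarrow> ('u \<Rightarrow> 'u) \<Rightarrow> ennreal"
  where "ent R L M \<phi> = (SUP N \<in> Fin_L R L M. ent_at L M \<phi> N)"


section \<open>Polynomials, Laurent polynomials and base change\<close>

text \<open>The \<open>R[X]\<close>-module \<open>M\<^sub>\<phi>\<close>, where \<open>R[X]\<close> is \<^term>\<open>UP R\<close>: the polynomial
  with coefficients \<open>p\<^sub>i\<close> sends \<open>x\<close> to the sum of the \<open>\<phi>\<^sup>i(x) p\<^sub>i\<close>.\<close>

definition poly_module ::
  "('a, 'k) ring_scheme \<Rightarrow> ('a, 'b) rmod \<Rightarrow> ('b \<Rightarrow> 'b) \<Rightarrow> (nat \<Rightarrow> 'a, 'b) rmod"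
  where "poly_module R M \<phi> =
    \<lparr>carrier = carrier M, monoid.mult = monoid.mult M, one = one M,
     ring.zero = ring.zero M, ring.add = ring.add M,
     ract = (\<lambda>x p. \<Oplus>\<^bsub>M\<^esub> i \<in> {..deg R p}. (\<phi> ^^ i) x \<lhd>\<^bsub>M\<^esub> coeff (UP R) p i)\<rparr>"

text \<open>The objects of the class \<open>lFin\<^sub>L[X]\<close>, given by the data \<open>M\<close> and \<open>\<phi>\<close> that
  define \<open>M\<^sub>\<phi>\<close>.\<close>

definition lFinX ::
  "('a, 'k) ring_scheme \<Rightarrow> (('a, 'u) rmod \<Rightarrow> ennreal) \<Rightarrow> ('a, 'u) rmod \<Rightarrow> ('u \<Rightarrow> 'u) \<Rightarrow> bool"
  where "lFinX R L M \<phi> \<longleftrightarrow>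
    right_module R M \<and> \<phi> \<in> rmod_hom R M M \<and> locally_L_finite R L M"

definition laurent_carrier :: "('a, 'k) ring_scheme \<Rightarrow> (int \<Rightarrow> 'a) set"
  where "laurent_carrier R = {p. range p \<subseteq> carrier R \<and> finite {i. p i \<noteq> \<zero>\<^bsub>R\<^esub>}}"

definition laurent :: "('a, 'k) ring_scheme \<Rightarrow> (int \<Rightarrow> 'a) ring"
  where "laurent R =
    \<lparr>carrier = laurent_carrier R,
     monoid.mult = (\<lambda>p q k. \<Oplus>\<^bsub>R\<^esub> i \<in> {i. p i \<noteq> \<zero>\<^bsub>R\<^esub>}. p i \<otimes>\<^bsub>R\<^esub> q (k - i)),
     one = (\<lambda>k. if k = 0 then \<one>\<^bsub>R\<^esub> else \<zero>\<^bsub>R\<^esub>),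
     ring.zero = (\<lambda>k. \<zero>\<^bsub>R\<^esub>),
     ring.add = (\<lambda>p q k. p k \<oplus>\<^bsub>R\<^esub> q k)\<rparr>"

definition laurent_const :: "('a, 'k) ring_scheme \<Rightarrow> 'a \<Rightarrow> int \<Rightarrow> 'a"
  where "laurent_const R r = (\<lambda>k. if k = 0 then r else \<zero>\<^bsub>R\<^esub>)"

definition laurent_X :: "('a, 'k) ring_scheme \<Rightarrow> int \<Rightarrow> 'a"
  where "laurent_X R = (\<lambda>k. if k = 1 then \<one>\<^bsub>R\<^esub> else \<zero>\<^bsub>R\<^esub>)"

definition laurent_of_poly :: "('a, 'k) ring_scheme \<Rightarrow> (nat \<Rightarrow> 'a) \<Rightarrow> int \<Rightarrow> 'a"
  where "laurent_of_poly R p = (\<lambda>k. if k < 0 then \<zero>\<^bsub>R\<^esub> else coeff (UP R) p (nat k))"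

text \<open>
  The tensor product over \<open>S\<close> of a right \<open>S\<close>-module \<open>A\<close> and a ring \<open>T\<close>, where \<open>T\<close> is a left
  \<open>S\<close>-module via a ring homomorphism \<open>\<iota>\<close> from \<open>S\<close> to \<open>T\<close>: the free abelian group on the pairs
  \<open>(a, b)\<close> modulo the biadditivity and balancing relations, with \<open>T\<close> acting on the right by
  multiplication on the second factor. The class of \<open>f\<close> is the coset of \<open>f\<close>.
\<close>

definition tensor_relations ::
  "('s, 'k) ring_scheme \<Rightarrow> ('t, 'l) ring_scheme \<Rightarrow> ('s \<Rightarrow> 't) \<Rightarrow> ('s, 'b) rmod
    \<Rightarrow> ('b \<times> 't \<Rightarrow>\<^sub>0 int) set"
  where "tensor_relations S T \<iota> A =
    {frag_of (a \<oplus>\<^bsub>A\<^esub> a', b) - frag_of (a, b) - frag_of (a', b) | a a' b.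
       a \<in> carrier A \<and> a' \<in> carrier A \<and> b \<in> carrier T} \<union>
    {frag_of (a, b \<oplus>\<^bsub>T\<^esub> b') - frag_of (a, b) - frag_of (a, b') | a b b'.
       a \<in> carrier A \<and> b \<in> carrier T \<and> b' \<in> carrier T} \<union>
    {frag_of (a \<lhd>\<^bsub>A\<^esub> s, b) - frag_of (a, \<iota> s \<otimes>\<^bsub>T\<^esub> b) | a s b.
       a \<in> carrier A \<and> s \<in> carrier S \<and> b \<in> carrier T}"

definition base_change ::
  "('s, 'k) ring_scheme \<Rightarrow> ('t, 'l) ring_scheme \<Rightarrow> ('s \<Rightarrow> 't) \<Rightarrow> ('s, 'b) rmod
    \<Rightarrow> ('t, ('b \<times> 't \<Rightarrow>\<^sub>0 int) set) rmod"
  where "base_change S T \<iota> A =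
    (let G = free_Abelian_group (carrier A \<times> carrier T);
         H = generate G (tensor_relations S T \<iota> A);
         Q = G Mod H
     in \<lparr>carrier = carrier Q, monoid.mult = undefined, one = undefined,
         ring.zero = one Q, ring.add = monoid.mult Q,
         ract = (\<lambda>C t. \<Union>f \<in> C.
           H #>\<^bsub>G\<^esub> frag_extend (\<lambda>(a, b). frag_of (a, b \<otimes>\<^bsub>T\<^esub> t)) f)\<rparr>)"

text \<open>
  A length function on the modules in \<^typ>\<open>'u\<close> can be evaluated only at a copy in \<^typ>\<open>'u\<close> of the
  tensor product of \<open>M\<^sub>\<phi>\<close> with the Laurent polynomials; \<open>P\<close> is such a copy. If \<open>M\<close> is a
  module in \<^typ>\<open>'u\<close>, then one exists: the tensor product is the increasing union over \<open>k\<close> of the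
  images of \<open>M\<close> under the maps sending \<open>x\<close> to the class of \<open>(x, X\<^sup>-\<^sup>k)\<close>, hence its cardinality
  is at most that of \<open>M\<close> (both if \<open>M\<close> is finite and if \<open>M\<close> is infinite).
\<close>

definition is_laurent_extension ::
  "('a, 'k) ring_scheme \<Rightarrow> ('a, 'u) rmod \<Rightarrow> ('u \<Rightarrow> 'u) \<Rightarrow> (int \<Rightarrow> 'a, 'u) rmod \<Rightarrow> bool"
  where "is_laurent_extension R M \<phi> P \<longleftrightarrow>
    right_module (laurent R) P \<and>
    rmod_isomorphic (laurent R) P
      (base_change (UP R) (laurent R) (laurent_of_poly R) (poly_module R M \<phi>))"

end

theory Submission
  imports Defs
begin

text \<open>
  Let \<open>f : M \<rightarrow> N\<close> send \<open>x\<close> to \<open>x \<otimes> 1\<close>. It intertwines \<open>\<phi>\<close> with the automorphism \<open>\<psi>\<close>, its kernel is the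
  union of the \<open>ker \<phi>\<^sup>m\<close>, and every element of \<open>N\<close> is carried into \<open>f M\<close> by a power of \<open>\<psi>\<close>.
  By Fekete's lemma the entropy at an \<open>L\<close>-finite submodule is the infimum of \<open>L(T\<^sub>n) / n\<close>.

  For \<open>ent \<phi> \<le> ent \<psi>\<close>: if \<open>L A < \<infinity>\<close> then \<open>L(f T\<^sub>n A)\<close> is the infimum over \<open>m\<close> of
  \<open>L(\<phi>\<^sup>m T\<^sub>n A) = L(T\<^sub>n(\<phi>\<^sup>m A))\<close>, and \<open>\<phi>\<^sup>m A\<close> has the same entropy as \<open>A\<close> since
  \<open>T\<^bsub>m+n\<^esub> A = T\<^sub>m A + \<phi>\<^sup>m T\<^sub>n A\<close>; so \<open>f A\<close> has at least the entropy of \<open>A\<close>.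

  For \<open>ent \<psi> \<le> ent \<phi>\<close>: an \<open>L\<close>-finite \<open>H \<subseteq> N\<close> has a finitely generated submodule \<open>K\<close> with
  \<open>L H \<le> L K + c\<close>, whence \<open>L(T\<^sub>n H) \<le> L(T\<^sub>n K) + n c\<close>. A power of \<open>\<psi>\<close> carries \<open>K\<close> into \<open>f F\<close> for a
  finitely generated \<open>F \<subseteq> M\<close>, which is \<open>L\<close>-finite because \<open>M\<close> is locally \<open>L\<close>-finite, so \<open>L(T\<^sub>n K) \<le> L(T\<^sub>n F)\<close>.
\<close>

section \<open>Submodules and homomorphisms\<close>

context right_module
begin

lemma ract_zero_right: "x \<in> carrier M \<Longrightarrow> x \<lhd>\<^bsub>M\<^esub> \<zero>\<^bsub>R\<^esub> = \<zero>\<^bsub>M\<^esub>"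
  by (metis M.add.r_cancel_one ract_add_right ract_closed R.zero_closed R.add.r_one)

lemma ract_zero_left: "r \<in> carrier R \<Longrightarrow> \<zero>\<^bsub>M\<^esub> \<lhd>\<^bsub>M\<^esub> r = \<zero>\<^bsub>M\<^esub>"
  by (metis M.add.r_cancel_one ract_add_left ract_closed M.zero_closed M.add.r_one)

lemma ract_minus_one: "x \<in> carrier M \<Longrightarrow> x \<lhd>\<^bsub>M\<^esub> (\<ominus>\<^bsub>R\<^esub> \<one>\<^bsub>R\<^esub>) = \<ominus>\<^bsub>M\<^esub> x"
  by (metis M.minus_equality R.add.inv_closed R.l_neg R.one_closed ract_add_right ract_closed
      ract_one ract_zero_right)

lemma ract_minus_left: "\<lbrakk>x \<in> carrier M; r \<in> carrier R\<rbrakk> \<Longrightarrow> (\<ominus>\<^bsub>M\<^esub> x) \<lhd>\<^bsub>M\<^esub> r = \<ominus>\<^bsub>M\<^esub> (x \<lhd>\<^bsub>M\<^esub> r)"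
  by (metis M.minus_equality M.add.inv_closed M.l_neg ract_add_left ract_closed ract_zero_left)

text \<open>Negatives come from the module action: acting by \<open>-1\<close> negates an
  element.\<close>

lemma rsubmoduleI:
  assumes "H \<subseteq> carrier M" "\<zero>\<^bsub>M\<^esub> \<in> H"
    and "\<And>x y. x \<in> H \<Longrightarrow> y \<in> H \<Longrightarrow> x \<oplus>\<^bsub>M\<^esub> y \<in> H"
    and "\<And>x r. x \<in> H \<Longrightarrow> r \<in> carrier R \<Longrightarrow> x \<lhd>\<^bsub>M\<^esub> r \<in> H"
  shows "rsubmodule R H M"
  unfolding rsubmodule_def
proof (intro conjI ballI)
  show "subgroup H (add_monoid M)"
  proof (rule M.add.subgroupI)
    fix x assume "x \<in> H"
    then show "\<ominus>\<^bsub>M\<^esub> x \<in> H"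
      by (metis R.add.inv_closed R.one_closed assms(1,4) ract_minus_one subsetD)
  qed (use assms in auto)
qed (use assms in auto)

lemma rsubmodule_self: "rsubmodule R (carrier M) M"
  by (rule rsubmoduleI) (auto intro: ract_closed)

end

lemma rsubmodule_subset: "rsubmodule R H M \<Longrightarrow> H \<subseteq> carrier M"
  using subgroup.subset[of H "add_monoid M"] by (simp add: rsubmodule_def)

lemma rsubmodule_zero: "rsubmodule R H M \<Longrightarrow> \<zero>\<^bsub>M\<^esub> \<in> H"
  by (auto simp: rsubmodule_def dest: subgroup.one_closed)

lemma rsubmodule_add: "rsubmodule R H M \<Longrightarrow> x \<in> H \<Longrightarrow> y \<in> H \<Longrightarrow> x \<oplus>\<^bsub>M\<^esub> y \<in> H"
  by (auto simp: rsubmodule_def dest: subgroup.m_closed)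

lemma rsubmodule_ract: "rsubmodule R H M \<Longrightarrow> x \<in> H \<Longrightarrow> r \<in> carrier R \<Longrightarrow> x \<lhd>\<^bsub>M\<^esub> r \<in> H"
  by (auto simp: rsubmodule_def)

lemma rsubmodule_minus: "rsubmodule R H M \<Longrightarrow> x \<in> H \<Longrightarrow> \<ominus>\<^bsub>M\<^esub> x \<in> H"
  by (auto simp: rsubmodule_def a_inv_def dest: subgroup.m_inv_closed)

lemmas rsubmodule_closed = rsubmodule_zero rsubmodule_add rsubmodule_ract

lemma (in right_module) rsubmodule_right_module:
  assumes H: "rsubmodule R H M"
  shows "right_module R (M\<lparr>carrier := H\<rparr>)"
proof -
  note sub = rsubmodule_subset[OF H, THEN subsetD]
  have ag: "abelian_group (M\<lparr>carrier := H\<rparr>)"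
  proof (rule abelian_groupI)
    fix x assume "x \<in> carrier (M\<lparr>carrier := H\<rparr>)"
    then show "\<exists>y\<in>carrier (M\<lparr>carrier := H\<rparr>). y \<oplus>\<^bsub>M\<lparr>carrier := H\<rparr>\<^esub> x = \<zero>\<^bsub>M\<lparr>carrier := H\<rparr>\<^esub>"
      using rsubmodule_minus[OF H] sub M.l_neg by auto
  qed (use rsubmodule_closed[OF H] sub in \<open>auto simp: M.a_assoc intro: M.a_comm\<close>)
  show ?thesis
    by (intro right_module.intro R.ring_axioms ag right_module_axioms.intro)
      (use rsubmodule_closed[OF H] sub in
        \<open>auto simp: ract_add_left ract_add_right ract_assoc ract_one\<close>)
qed

text \<open>Upper continuity of \<open>L\<close> at a submodule speaks of submodules of the
  restricted record; this carries them to the ambient module, where lengths are compared.\<close>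

lemma (in right_module) rsubmodule_restrict_iff:
  assumes H: "rsubmodule R H M"
  shows "rsubmodule R K (M\<lparr>carrier := H\<rparr>) \<longleftrightarrow> rsubmodule R K M \<and> K \<subseteq> H"
proof
  interpret H: right_module R "M\<lparr>carrier := H\<rparr>" by (rule rsubmodule_right_module[OF H])
  show "rsubmodule R K M \<and> K \<subseteq> H" if K: "rsubmodule R K (M\<lparr>carrier := H\<rparr>)"
    using rsubmodule_subset[OF K] rsubmodule_closed[OF K] rsubmodule_subset[OF H]
    by (auto intro!: rsubmoduleI)
  show "rsubmodule R K (M\<lparr>carrier := H\<rparr>)" if "rsubmodule R K M \<and> K \<subseteq> H"
    using that rsubmodule_closed[of R K M] by (auto intro!: H.rsubmoduleI)
qed

section \<open>Homomorphisms, with images and preimages of submodules\<close>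

lemma rmod_homI:
  assumes "\<And>x. x \<in> carrier M \<Longrightarrow> f x \<in> carrier N"
    and "\<And>x y. x \<in> carrier M \<Longrightarrow> y \<in> carrier M \<Longrightarrow> f (x \<oplus>\<^bsub>M\<^esub> y) = f x \<oplus>\<^bsub>N\<^esub> f y"
    and "\<And>x r. x \<in> carrier M \<Longrightarrow> r \<in> carrier R \<Longrightarrow> f (x \<lhd>\<^bsub>M\<^esub> r) = f x \<lhd>\<^bsub>N\<^esub> r"
  shows "f \<in> rmod_hom R M N"
  using assms by (auto simp: rmod_hom_def hom_def)

lemma rmod_homD:
  assumes "f \<in> rmod_hom R M N"
  shows rmod_hom_closed: "x \<in> carrier M \<Longrightarrow> f x \<in> carrier N"
    and rmod_hom_add: "x \<in> carrier M \<Longrightarrow> y \<in> carrier M \<Longrightarrow> f (x \<oplus>\<^bsub>M\<^esub> y) = f x \<oplus>\<^bsub>N\<^esub> f y"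
    and rmod_hom_ract: "x \<in> carrier M \<Longrightarrow> r \<in> carrier R \<Longrightarrow> f (x \<lhd>\<^bsub>M\<^esub> r) = f x \<lhd>\<^bsub>N\<^esub> r"
  using assms by (auto simp: rmod_hom_def hom_def Pi_iff)

lemma rmod_hom_zero:
  assumes "right_module R M" "right_module R N" "f \<in> rmod_hom R M N"
  shows "f \<zero>\<^bsub>M\<^esub> = \<zero>\<^bsub>N\<^esub>"
proof -
  interpret M: right_module R M by fact
  interpret N: right_module R N by fact
  show ?thesis
    by (metis M.M.zero_closed M.M.l_zero N.M.add.r_cancel_one rmod_homD(1,2)[OF assms(3)])
qed

lemma rmod_hom_funpow: "\<phi> \<in> rmod_hom R M M \<Longrightarrow> \<phi> ^^ n \<in> rmod_hom R M M"
proof (induction n)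
  case (Suc n)
  note h = rmod_homD[OF Suc.prems] and i = rmod_homD[OF Suc.IH[OF Suc.prems]]
  show ?case by (rule rmod_homI) (simp_all add: h i)
qed (auto intro!: rmod_homI)

lemma rmod_hom_image:
  assumes "right_module R M" "right_module R N" "f \<in> rmod_hom R M N" "rsubmodule R A M"
  shows "rsubmodule R (f ` A) N"
proof -
  interpret N: right_module R N by fact
  note sub = rsubmodule_subset[OF assms(4), THEN subsetD]
  note f = rmod_homD[OF assms(3)]
  show ?thesis
  proof (rule N.rsubmoduleI)
    show "\<zero>\<^bsub>N\<^esub> \<in> f ` A"
      using rmod_hom_zero[OF assms(1-3)] rsubmodule_zero[OF assms(4)] by (metis imageI)
    show "x \<oplus>\<^bsub>N\<^esub> y \<in> f ` A" if "x \<in> f ` A" "y \<in> f ` A" for x y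
      using that rsubmodule_add[OF assms(4)] f(2)[OF sub sub, symmetric] by auto
    show "x \<lhd>\<^bsub>N\<^esub> r \<in> f ` A" if "x \<in> f ` A" "r \<in> carrier R" for x r
      using that rsubmodule_ract[OF assms(4)] f(3)[OF sub, symmetric] by auto
  qed (use f sub in auto)
qed

lemma rmod_hom_vimage:
  assumes "right_module R M" "right_module R N" "f \<in> rmod_hom R M N"
    and "rsubmodule R A M" "rsubmodule R B N"
  shows "rsubmodule R {x \<in> A. f x \<in> B} M"
proof -
  interpret M: right_module R M by fact
  note sub = rsubmodule_subset[OF assms(4), THEN subsetD]
  show ?thesis
    by (rule M.rsubmoduleI)
      (use sub rsubmodule_closed[OF assms(4)] rsubmodule_closed[OF assms(5)] rmod_homD[OF assms(3)]
        rmod_hom_zero[OF assms(1-3)] in auto)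
qed

section \<open>Sums, spans and quotients\<close>

context right_module
begin

lemma rsubmodule_trivial: "rsubmodule R {\<zero>\<^bsub>M\<^esub>} M"
  by (rule rsubmoduleI) (auto simp: ract_zero_left)

lemma rsubmodule_Int: "rsubmodule R A M \<Longrightarrow> rsubmodule R B M \<Longrightarrow> rsubmodule R (A \<inter> B) M"
  by (rule rsubmoduleI) (use rsubmodule_subset in \<open>auto simp: rsubmodule_closed\<close>)

lemma set_addI: "a \<in> A \<Longrightarrow> b \<in> B \<Longrightarrow> a \<oplus>\<^bsub>M\<^esub> b \<in> A <+>\<^bsub>M\<^esub> B"
  by (auto simp: set_add_def')

lemma set_addE:
  assumes "z \<in> A <+>\<^bsub>M\<^esub> B"
  obtains a b where "a \<in> A" "b \<in> B" "z = a \<oplus>\<^bsub>M\<^esub> b"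
  using assms by (auto simp: set_add_def')

lemma set_add_comm: "A \<subseteq> carrier M \<Longrightarrow> B \<subseteq> carrier M \<Longrightarrow> A <+>\<^bsub>M\<^esub> B = B <+>\<^bsub>M\<^esub> A"
  by (auto elim!: set_addE) (metis M.a_comm set_addI subsetD)+

lemma rsubmodule_set_add:
  assumes A: "rsubmodule R A M" and B: "rsubmodule R B M"
  shows "rsubmodule R (A <+>\<^bsub>M\<^esub> B) M"
proof (rule rsubmoduleI)
  note sub = rsubmodule_subset[OF A, THEN subsetD] rsubmodule_subset[OF B, THEN subsetD]
  show "A <+>\<^bsub>M\<^esub> B \<subseteq> carrier M" using sub by (auto elim!: set_addE)
  show "\<zero>\<^bsub>M\<^esub> \<in> A <+>\<^bsub>M\<^esub> B"
    using set_addI[OF rsubmodule_zero[OF A] rsubmodule_zero[OF B]] by simp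
  show "x \<oplus>\<^bsub>M\<^esub> y \<in> A <+>\<^bsub>M\<^esub> B" if x: "x \<in> A <+>\<^bsub>M\<^esub> B" and y: "y \<in> A <+>\<^bsub>M\<^esub> B" for x y
  proof -
    obtain a b where 1: "a \<in> A" "b \<in> B" "x = a \<oplus>\<^bsub>M\<^esub> b" using x by (rule set_addE)
    obtain a' b' where 2: "a' \<in> A" "b' \<in> B" "y = a' \<oplus>\<^bsub>M\<^esub> b'" using y by (rule set_addE)
    have "x \<oplus>\<^bsub>M\<^esub> y = (a \<oplus>\<^bsub>M\<^esub> a') \<oplus>\<^bsub>M\<^esub> (b \<oplus>\<^bsub>M\<^esub> b')"
      using 1 2 sub by (simp add: M.a_ac)
    then show ?thesis
      using 1 2 rsubmodule_add[OF A] rsubmodule_add[OF B] by (simp add: set_addI)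
  qed
  show "x \<lhd>\<^bsub>M\<^esub> r \<in> A <+>\<^bsub>M\<^esub> B" if "x \<in> A <+>\<^bsub>M\<^esub> B" "r \<in> carrier R" for x r
    using that sub rsubmodule_ract[OF A] rsubmodule_ract[OF B]
    by (auto elim!: set_addE simp: ract_add_left intro!: set_addI)
qed

lemma set_add_upper1:
  assumes A: "rsubmodule R A M" and B: "rsubmodule R B M"
  shows "A \<subseteq> A <+>\<^bsub>M\<^esub> B"
  using set_addI[OF _ rsubmodule_zero[OF B], of _ A] rsubmodule_subset[OF A] by force

lemma set_add_absorb:
  assumes A: "rsubmodule R A M" and B: "rsubmodule R B M" and "B \<subseteq> A"
  shows "A <+>\<^bsub>M\<^esub> B = A"
  using set_add_upper1[OF A B] assms(3) rsubmodule_add[OF A] by (auto elim!: set_addE)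

lemma rspan_minimal: "rsubmodule R H M \<Longrightarrow> S \<subseteq> H \<Longrightarrow> rspan R M S \<subseteq> H"
  by (auto simp: rspan_def)

lemma rspan_superset: "S \<subseteq> rspan R M S"
  by (auto simp: rspan_def)

lemma rsubmodule_rspan:
  assumes "S \<subseteq> carrier M"
  shows "rsubmodule R (rspan R M S) M"
  by (rule rsubmoduleI)
    (use rspan_minimal[OF rsubmodule_self assms] in \<open>auto simp: rspan_def rsubmodule_closed\<close>)

text \<open>The quotient by \<open>A\<close>, realised inside the type of \<open>M\<close> on a set of coset representatives, so
  that a length function can be evaluated at it.\<close>

lemma ex_quotient:
  assumes A: "rsubmodule R A M"
  obtains Q :: "('a, 'b) rmod" and g where
    "right_module R Q" "g \<in> rmod_hom R M Q" "g ` carrier M = carrier Q"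
    "{x \<in> carrier M. g x = \<zero>\<^bsub>Q\<^esub>} = A"
proof -
  note sub = rsubmodule_subset[OF A, THEN subsetD]
  \<comment> \<open>The choice depends on \<open>x\<close> only through a predicate that describes
    its coset, so by \<open>g_cong\<close> all elements of a coset get the same
    representative.\<close>
  define g where "g x = (SOME y. y \<in> carrier M \<and> y \<ominus>\<^bsub>M\<^esub> x \<in> A)" for x
  have g: "g x \<in> carrier M" "g x \<ominus>\<^bsub>M\<^esub> x \<in> A" if "x \<in> carrier M" for x
  proof -
    have "x \<in> carrier M \<and> x \<ominus>\<^bsub>M\<^esub> x \<in> A"
      using that rsubmodule_zero[OF A] by (simp add: a_minus_def M.r_neg)
    from someI[of "\<lambda>y. y \<in> carrier M \<and> y \<ominus>\<^bsub>M\<^esub> x \<in> A", OF this]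
    show "g x \<in> carrier M" "g x \<ominus>\<^bsub>M\<^esub> x \<in> A" by (simp_all add: g_def)
  qed
  have g_cong: "g x = g y" if "x \<in> carrier M" "y \<in> carrier M" "x \<ominus>\<^bsub>M\<^esub> y \<in> A" for x y
  proof -
    have "z \<ominus>\<^bsub>M\<^esub> x \<in> A \<longleftrightarrow> z \<ominus>\<^bsub>M\<^esub> y \<in> A" if z: "z \<in> carrier M" for z
    proof -
      have "z \<ominus>\<^bsub>M\<^esub> y = (z \<ominus>\<^bsub>M\<^esub> x) \<oplus>\<^bsub>M\<^esub> (x \<ominus>\<^bsub>M\<^esub> y)"
        using z \<open>x \<in> carrier M\<close> \<open>y \<in> carrier M\<close> by (simp add: a_minus_def M.a_assoc M.r_neg1)
      moreover have "z \<ominus>\<^bsub>M\<^esub> x = (z \<ominus>\<^bsub>M\<^esub> y) \<oplus>\<^bsub>M\<^esub> (y \<ominus>\<^bsub>M\<^esub> x)"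
        using z \<open>x \<in> carrier M\<close> \<open>y \<in> carrier M\<close> by (simp add: a_minus_def M.a_assoc M.r_neg1)
      moreover have "y \<ominus>\<^bsub>M\<^esub> x = \<ominus>\<^bsub>M\<^esub> (x \<ominus>\<^bsub>M\<^esub> y)"
        using \<open>x \<in> carrier M\<close> \<open>y \<in> carrier M\<close> by (simp add: a_minus_def M.minus_add M.a_comm)
      ultimately show ?thesis
        using rsubmodule_add[OF A] rsubmodule_minus[OF A] \<open>x \<ominus>\<^bsub>M\<^esub> y \<in> A\<close> by metis
    qed
    then show ?thesis unfolding g_def by metis
  qed
  have g_eqD: "x \<ominus>\<^bsub>M\<^esub> y \<in> A" if "x \<in> carrier M" "y \<in> carrier M" "g x = g y" for x y
  proof -
    have "x \<ominus>\<^bsub>M\<^esub> y = (x \<ominus>\<^bsub>M\<^esub> g y) \<oplus>\<^bsub>M\<^esub> (g y \<ominus>\<^bsub>M\<^esub> y)"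
      using that(1,2) g(1)[OF that(2)] by (simp add: a_minus_def M.a_assoc M.r_neg1)
    moreover have "x \<ominus>\<^bsub>M\<^esub> g y = \<ominus>\<^bsub>M\<^esub> (g x \<ominus>\<^bsub>M\<^esub> x)"
      using that g(1)[OF that(2)] by (simp add: a_minus_def M.minus_add M.a_comm)
    ultimately show ?thesis
      using g(2) that rsubmodule_add[OF A] rsubmodule_minus[OF A] by metis
  qed
  have g_add: "g (g x \<oplus>\<^bsub>M\<^esub> g y) = g (x \<oplus>\<^bsub>M\<^esub> y)" if "x \<in> carrier M" "y \<in> carrier M" for x y
  proof (rule g_cong)
    have "(g x \<oplus>\<^bsub>M\<^esub> g y) \<ominus>\<^bsub>M\<^esub> (x \<oplus>\<^bsub>M\<^esub> y) = (g x \<ominus>\<^bsub>M\<^esub> x) \<oplus>\<^bsub>M\<^esub> (g y \<ominus>\<^bsub>M\<^esub> y)"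
      using that g(1) by (simp add: a_minus_def M.minus_add M.a_ac)
    then show "(g x \<oplus>\<^bsub>M\<^esub> g y) \<ominus>\<^bsub>M\<^esub> (x \<oplus>\<^bsub>M\<^esub> y) \<in> A"
      using that g(2) rsubmodule_add[OF A] by simp
  qed (use that g(1) in auto)
  have g_ract: "g (g x \<lhd>\<^bsub>M\<^esub> r) = g (x \<lhd>\<^bsub>M\<^esub> r)" if "x \<in> carrier M" "r \<in> carrier R" for x r
  proof (rule g_cong)
    have "(g x \<lhd>\<^bsub>M\<^esub> r) \<ominus>\<^bsub>M\<^esub> (x \<lhd>\<^bsub>M\<^esub> r) = (g x \<ominus>\<^bsub>M\<^esub> x) \<lhd>\<^bsub>M\<^esub> r"
      using that g(1) by (simp add: a_minus_def ract_add_left ract_minus_left)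
    then show "(g x \<lhd>\<^bsub>M\<^esub> r) \<ominus>\<^bsub>M\<^esub> (x \<lhd>\<^bsub>M\<^esub> r) \<in> A"
      using that g(2) rsubmodule_ract[OF A] by simp
  qed (use that g(1) ract_closed in auto)
  \<comment> \<open>The operations are those of \<open>M\<close> followed by a return to
    representatives; \<open>g_add\<close> and \<open>g_ract\<close> show that the result depends
    only on the cosets.\<close>
  define Q :: "('a, 'b) rmod" where
    "Q = \<lparr>carrier = g ` carrier M, monoid.mult = undefined, one = undefined,
          ring.zero = g \<zero>\<^bsub>M\<^esub>, ring.add = (\<lambda>x y. g (x \<oplus>\<^bsub>M\<^esub> y)), ract = (\<lambda>x r. g (x \<lhd>\<^bsub>M\<^esub> r))\<rparr>"
  have Q: "carrier Q = g ` carrier M" "\<zero>\<^bsub>Q\<^esub> = g \<zero>\<^bsub>M\<^esub>"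
    and Qadd: "\<And>x y. x \<in> carrier M \<Longrightarrow> y \<in> carrier M \<Longrightarrow> g x \<oplus>\<^bsub>Q\<^esub> g y = g (x \<oplus>\<^bsub>M\<^esub> y)"
    and Qract: "\<And>x r. x \<in> carrier M \<Longrightarrow> r \<in> carrier R \<Longrightarrow> g x \<lhd>\<^bsub>Q\<^esub> r = g (x \<lhd>\<^bsub>M\<^esub> r)"
    by (simp_all add: Q_def g_add g_ract)
  have ag: "abelian_group Q"
  proof (rule abelian_groupI)
    fix x assume "x \<in> carrier Q"
    then obtain y where "y \<in> carrier M" "x = g y" by (auto simp: Q)
    then show "\<exists>y\<in>carrier Q. y \<oplus>\<^bsub>Q\<^esub> x = \<zero>\<^bsub>Q\<^esub>"
      by (intro bexI[of _ "g (\<ominus>\<^bsub>M\<^esub> y)"]) (simp_all add: Q Qadd M.l_neg)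
  qed (auto simp: Q Qadd M.a_ac)
  show thesis
  proof (rule that)
    show "right_module R Q"
      by (intro right_module.intro R.ring_axioms ag right_module_axioms.intro)
        (auto simp: Q Qadd Qract ract_closed ract_add_left ract_add_right ract_assoc ract_one)
    show "g \<in> rmod_hom R M Q" by (rule rmod_homI) (auto simp: Q Qadd Qract)
    show "g ` carrier M = carrier Q" by (simp add: Q)
    have "g x = g \<zero>\<^bsub>M\<^esub> \<longleftrightarrow> x \<in> A" if "x \<in> carrier M" for x
      using that g_eqD[of x "\<zero>\<^bsub>M\<^esub>"] g_cong[of x "\<zero>\<^bsub>M\<^esub>"]
      by (auto simp: a_minus_def M.minus_equality[of "\<zero>\<^bsub>M\<^esub>"])
    then show "{x \<in> carrier M. g x = \<zero>\<^bsub>Q\<^esub>} = A"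
      using sub by (auto simp: Q)
  qed
qed

end


section \<open>Length functions\<close>

text \<open>Each element of \<open>S\<close> lies in some member of the chain, and the largest of
  the finitely many indices serves for all. This yields both the continuity of \<open>L\<close>
  along chains and a common power of \<open>\<psi>\<close> for finitely many elements.\<close>

lemma finite_subset_incseq:
  fixes C :: "nat \<Rightarrow> 'b set"
  assumes "finite S" "S \<subseteq> (\<Union>m. C m)" "incseq C"
  obtains m where "S \<subseteq> C m"
proof -
  obtain k where k: "\<And>x. x \<in> S \<Longrightarrow> x \<in> C (k x)" using assms(2) by (metis UN_E subsetD)
  obtain m where "k ` S \<subseteq> {..m}"
    using finite_nat_iff_bounded_le[of "k ` S"] assms(1) by auto
  then have "S \<subseteq> C m" using k incseqD[OF assms(3), of "k _" m] by (auto simp: subset_iff)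
  then show thesis by (rule that)
qed

locale length_fun = R?: ring R
  for R :: "('a, 'k) ring_scheme" (structure) +
  fixes L :: "('a, 'u) rmod \<Rightarrow> ennreal"
  assumes length_function: "length_function R L"
begin

lemma length_trivial: "right_module R M \<Longrightarrow> carrier M = {\<zero>\<^bsub>M\<^esub>} \<Longrightarrow> L M = 0"
  using length_function unfolding length_function_def by blast

lemma length_additive: "short_exact R M' f M g M'' \<Longrightarrow> L M = L M' + L M''"
  using length_function unfolding length_function_def by blast

lemma length_continuous:
  "right_module R M \<Longrightarrow> L M = (SUP F \<in> {F. fg_rsubmodule R F M}. L (M\<lparr>carrier := F\<rparr>))"
  using length_function unfolding length_function_def by blast

text \<open>Additivity for the exact sequence formed by the kernel of \<open>f\<close> on
  \<open>A\<close>, \<open>A\<close> itself and its image. Monotonicity, the modular law and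
  invariance under injections are all read off from it.\<close>

lemma length_kernel_image:
  assumes M: "right_module R M" and N: "right_module R N" and f: "f \<in> rmod_hom R M N"
    and A: "rsubmodule R A M"
  shows "L (M\<lparr>carrier := A\<rparr>) = L (M\<lparr>carrier := {x \<in> A. f x = \<zero>\<^bsub>N\<^esub>}\<rparr>) + L (N\<lparr>carrier := f ` A\<rparr>)"
proof (rule length_additive)
  interpret M: right_module R M by fact
  interpret N: right_module R N by fact
  note sub = rsubmodule_subset[OF A, THEN subsetD]
  have K: "rsubmodule R {x \<in> A. f x = \<zero>\<^bsub>N\<^esub>} M"
    using rmod_hom_vimage[OF M N f A N.rsubmodule_trivial] by simp
  have "f \<in> rmod_hom R (M\<lparr>carrier := A\<rparr>) (N\<lparr>carrier := f ` A\<rparr>)"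
    by (rule rmod_homI) (use sub rmod_homD[OF f] in auto)
  moreover have "id \<in> rmod_hom R (M\<lparr>carrier := {x \<in> A. f x = \<zero>\<^bsub>N\<^esub>}\<rparr>) (M\<lparr>carrier := A\<rparr>)"
    by (rule rmod_homI) auto
  ultimately show "short_exact R (M\<lparr>carrier := {x \<in> A. f x = \<zero>\<^bsub>N\<^esub>}\<rparr>) id (M\<lparr>carrier := A\<rparr>) f
      (N\<lparr>carrier := f ` A\<rparr>)"
    using M.rsubmodule_right_module[OF K] M.rsubmodule_right_module[OF A]
      N.rsubmodule_right_module[OF rmod_hom_image[OF M N f A]]
    by (auto simp: short_exact_def)
qed

lemma length_image_le:
  assumes "right_module R M" "right_module R N" "f \<in> rmod_hom R M N" "rsubmodule R A M"
  shows "L (N\<lparr>carrier := f ` A\<rparr>) \<le> L (M\<lparr>carrier := A\<rparr>)"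
  by (simp add: length_kernel_image[OF assms])

lemma length_inj_image:
  assumes M: "right_module R M" and N: "right_module R N" and f: "f \<in> rmod_hom R M N"
    and A: "rsubmodule R A M" and inj: "inj_on f (carrier M)"
  shows "L (N\<lparr>carrier := f ` A\<rparr>) = L (M\<lparr>carrier := A\<rparr>)"
proof -
  interpret M: right_module R M by fact
  have "x = \<zero>\<^bsub>M\<^esub>" if "x \<in> A" "f x = \<zero>\<^bsub>N\<^esub>" for x
    using that rsubmodule_subset[OF A] inj rmod_hom_zero[OF M N f]
    by (auto dest!: inj_onD[of f _ x "\<zero>\<^bsub>M\<^esub>"])
  then have "{x \<in> A. f x = \<zero>\<^bsub>N\<^esub>} \<subseteq> {\<zero>\<^bsub>M\<^esub>}" by blast
  moreover have "{\<zero>\<^bsub>M\<^esub>} \<subseteq> {x \<in> A. f x = \<zero>\<^bsub>N\<^esub>}"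
    using rsubmodule_zero[OF A] rmod_hom_zero[OF M N f] by simp
  ultimately have "{x \<in> A. f x = \<zero>\<^bsub>N\<^esub>} = {\<zero>\<^bsub>M\<^esub>}" by (rule equalityI)
  moreover have "L (M\<lparr>carrier := {\<zero>\<^bsub>M\<^esub>}\<rparr>) = 0"
    by (rule length_trivial[OF M.rsubmodule_right_module[OF M.rsubmodule_trivial]]) simp
  ultimately show ?thesis using length_kernel_image[OF M N f A] by simp
qed

text \<open>Both sides equal \<open>L A + L ((A + B) / A) + L (A \<inter> B)\<close>.\<close>

lemma length_modular:
  assumes M: "right_module R M" and A: "rsubmodule R A M" and B: "rsubmodule R B M"
  shows "L (M\<lparr>carrier := A <+>\<^bsub>M\<^esub> B\<rparr>) + L (M\<lparr>carrier := A \<inter> B\<rparr>)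
    = L (M\<lparr>carrier := A\<rparr>) + L (M\<lparr>carrier := B\<rparr>)"
proof -
  interpret M: right_module R M by fact
  obtain Q :: "('a, 'u) rmod" and g where Q: "right_module R Q" and g: "g \<in> rmod_hom R M Q"
    and ker: "{x \<in> carrier M. g x = \<zero>\<^bsub>Q\<^esub>} = A"
    using M.ex_quotient[OF A] by metis
  interpret Q: right_module R Q by fact
  note sub = rsubmodule_subset[OF A, THEN subsetD] rsubmodule_subset[OF B, THEN subsetD]
  have gA: "g x = \<zero>\<^bsub>Q\<^esub>" if "x \<in> A" for x using that ker by auto
  have AB: "rsubmodule R (A <+>\<^bsub>M\<^esub> B) M" by (rule M.rsubmodule_set_add[OF A B])
  have "g (a \<oplus>\<^bsub>M\<^esub> b) = g b" if "a \<in> A" "b \<in> B" for a b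
    using that sub rmod_homD[OF g] gA by simp
  moreover have "B \<subseteq> A <+>\<^bsub>M\<^esub> B"
    using M.set_add_upper1[OF B A] M.set_add_comm[of A B] sub by blast
  \<comment> \<open>\<open>g\<close> annihilates \<open>A\<close>, so \<open>A + B\<close> and
    \<open>B\<close> have the same image, a copy of \<open>(A + B) / A\<close>.\<close>
  ultimately have im: "g ` (A <+>\<^bsub>M\<^esub> B) = g ` B"
    by (auto elim!: M.set_addE)
  have "{x \<in> A <+>\<^bsub>M\<^esub> B. g x = \<zero>\<^bsub>Q\<^esub>} = A"
    using M.set_add_upper1[OF A B] rsubmodule_subset[OF AB] ker by auto
  moreover have "{x \<in> B. g x = \<zero>\<^bsub>Q\<^esub>} = A \<inter> B"
    using ker sub by auto
  ultimately show ?thesis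
    using length_kernel_image[OF M Q g AB] length_kernel_image[OF M Q g B] im
    by (simp add: ac_simps)
qed

lemma length_set_add_le:
  assumes "right_module R M" "rsubmodule R A M" "rsubmodule R B M"
  shows "L (M\<lparr>carrier := A <+>\<^bsub>M\<^esub> B\<rparr>) \<le> L (M\<lparr>carrier := A\<rparr>) + L (M\<lparr>carrier := B\<rparr>)"
  by (simp flip: length_modular[OF assms])

text \<open>With \<open>g\<close> the quotient map by \<open>A\<close>, the length of
  \<open>B\<close> is that of \<open>A\<close> plus that of the image \<open>B / A\<close>.\<close>

lemma length_mono:
  assumes M: "right_module R M" and A: "rsubmodule R A M" and B: "rsubmodule R B M" and "A \<subseteq> B"
  shows "L (M\<lparr>carrier := A\<rparr>) \<le> L (M\<lparr>carrier := B\<rparr>)"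
proof -
  interpret M: right_module R M by fact
  obtain Q :: "('a, 'u) rmod" and g where Q: "right_module R Q" and g: "g \<in> rmod_hom R M Q"
    and ker: "{x \<in> carrier M. g x = \<zero>\<^bsub>Q\<^esub>} = A"
    using M.ex_quotient[OF A] by metis
  have "{x \<in> B. g x = \<zero>\<^bsub>Q\<^esub>} = A"
    using ker \<open>A \<subseteq> B\<close> rsubmodule_subset[OF B] by auto
  then show ?thesis using length_kernel_image[OF M Q g B] by simp
qed

text \<open>The upper bound uses upper continuity: a finitely generated submodule of the union has
  its generators, hence all of itself, in one member of the chain.\<close>

lemma length_Union_chain:
  fixes C :: "nat \<Rightarrow> 'u set"
  assumes M: "right_module R M" and C: "\<And>m. rsubmodule R (C m) M" and "incseq C"
  shows "L (M\<lparr>carrier := \<Union>m. C m\<rparr>) = (SUP m. L (M\<lparr>carrier := C m\<rparr>))"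
proof (rule antisym)
  interpret M: right_module R M by fact
  have U: "rsubmodule R (\<Union>m. C m) M"
  proof (rule M.rsubmoduleI)
    fix x y assume "x \<in> (\<Union>m. C m)" "y \<in> (\<Union>m. C m)"
    then obtain m n where "x \<in> C m" "y \<in> C n" by auto
    then have "x \<in> C (max m n)" "y \<in> C (max m n)"
      using \<open>incseq C\<close> by (meson incseqD max.cobounded1 max.cobounded2 subsetD)+
    then show "x \<oplus>\<^bsub>M\<^esub> y \<in> (\<Union>m. C m)" using rsubmodule_add[OF C] by blast
  qed (use rsubmodule_subset[OF C] rsubmodule_zero[OF C] in \<open>auto intro: rsubmodule_ract[OF C]\<close>)
  show "(SUP m. L (M\<lparr>carrier := C m\<rparr>)) \<le> L (M\<lparr>carrier := \<Union>m. C m\<rparr>)"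
    by (rule SUP_least) (auto intro!: length_mono[OF M C U])
  let ?U = "M\<lparr>carrier := \<Union>m. C m\<rparr>"
  interpret U: right_module R ?U by (rule M.rsubmodule_right_module[OF U])
  have "L (M\<lparr>carrier := F\<rparr>) \<le> (SUP m. L (M\<lparr>carrier := C m\<rparr>))" if F: "fg_rsubmodule R F ?U" for F
  proof -
    obtain S where S: "finite S" "S \<subseteq> (\<Union>m. C m)" "F = rspan R ?U S"
      using F unfolding fg_rsubmodule_def by auto
    obtain m where m: "S \<subseteq> C m"
      by (rule finite_subset_incseq[OF S(1,2) \<open>incseq C\<close>])
    have "rsubmodule R (C m) ?U" using M.rsubmodule_restrict_iff[OF U] C by blast
    then have "F \<subseteq> C m" using S m U.rspan_minimal by blast
    moreover have "rsubmodule R F M"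
      using U.rsubmodule_rspan[of S] S M.rsubmodule_restrict_iff[OF U] by auto
    ultimately show ?thesis
      by (intro SUP_upper2[of m] length_mono[OF M _ C]) auto
  qed
  then show "L ?U \<le> (SUP m. L (M\<lparr>carrier := C m\<rparr>))"
    by (subst length_continuous[OF U.right_module_axioms]) (auto intro!: SUP_least)
qed

end


section \<open>Subadditive sequences\<close>

lemma ennreal_const_over_n_tendsto_0:
  fixes c :: ennreal
  assumes "c < \<infinity>"
  shows "(\<lambda>n. c / of_nat n) \<longlonglongrightarrow> 0"
proof -
  obtain r where r: "c = ennreal r" "0 \<le> r" using assms by (cases c) auto
  have "(\<lambda>n. ennreal (r / real n)) \<longlonglongrightarrow> ennreal 0"
    by (intro tendsto_ennrealI lim_const_over_n)
  moreover have "\<forall>\<^sub>F n in sequentially. ennreal (r / real n) = c / of_nat n"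
    using eventually_gt_at_top[of 0]
    by eventually_elim (simp add: r ennreal_of_nat_eq_real_of_nat divide_ennreal)
  ultimately show ?thesis by (auto elim: Lim_transform_eventually)
qed

text \<open>Fekete's lemma. The infimum starts at 1 because the quotient with index 0 has the
  default value 0.\<close>

lemma subadditive_tendsto_INF:
  fixes a :: "nat \<Rightarrow> ennreal"
  assumes sub: "\<And>m n. a (m + n) \<le> a m + a n" and zero: "a 0 = 0" and fin: "\<And>n. a n < \<infinity>"
  shows "(\<lambda>n. a n / of_nat n) \<longlonglongrightarrow> (INF n\<in>{1..}. a n / of_nat n)"
proof -
  \<comment> \<open>Finite values allow the estimates to be made with real numbers, where fractions
    can be rearranged freely.\<close>
  define b where "b n = enn2real (a n)" for n
  have b: "a n = ennreal (b n)" "0 \<le> b n" for n using fin[of n] by (simp_all add: b_def)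
  have bsub: "b (m + n) \<le> b m + b n" for m n
    using sub[of m n] by (simp add: b flip: ennreal_plus)
  have b0: "b 0 = 0" by (simp add: b_def zero)
  have bmult: "b (q * m) \<le> real q * b m" for q m
  proof (induction q)
    case (Suc q)
    then show ?case using bsub[of m "q * m"] by (simp add: algebra_simps)
  qed (simp add: b0)
  have div: "a n / of_nat n = ennreal (b n / real n)" if "n \<ge> 1" for n
    using that by (simp add: b ennreal_of_nat_eq_real_of_nat divide_ennreal)
  \<comment> \<open>Divide \<open>n\<close> by \<open>m\<close> with remainder: the quotient part
    costs at most \<open>n / m\<close> copies of \<open>b m\<close>, the remainder at most
    \<open>m\<close> copies of \<open>b 1\<close>, which become negligible after division by a large
    \<open>n\<close>.\<close>
  have bound: "b n / real n \<le> b m / real m + real m * b 1 / real n" if "m \<ge> 1" "n \<ge> 1" for m n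
  proof -
    have "b n \<le> b (n div m * m) + b (n mod m * 1)" using bsub[of "n div m * m" "n mod m"] by simp
    also have "\<dots> \<le> real (n div m) * b m + real (n mod m) * b 1" by (intro add_mono bmult)
    also have "\<dots> \<le> real n / real m * b m + real m * b 1"
      using that by (intro add_mono mult_right_mono b)
        (simp_all add: of_nat_div_le_of_nat less_imp_le)
    finally show ?thesis using that by (simp add: field_simps)
  qed
  show ?thesis
  proof (rule order_tendstoI)
    fix l assume l: "l < (INF n\<in>{1..}. a n / of_nat n)"
    show "\<forall>\<^sub>F n in sequentially. l < a n / of_nat n"
      using eventually_ge_at_top[of 1]
      by eventually_elim (rule less_le_trans[OF l INF_lower], simp)
  next
    fix l assume "(INF n\<in>{1..}. a n / of_nat n) < l"
    then obtain m where m: "m \<ge> 1" "a m / of_nat m < l" by (auto simp: INF_less_iff)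
    \<comment> \<open>With \<open>m\<close> fixed, the right-hand side of \<open>bound\<close> tends
      to \<open>b m / m\<close>, which lies below \<open>l\<close>.\<close>
    have "(\<lambda>n. ennreal (b m / real m + real m * b 1 / real n)) \<longlonglongrightarrow> ennreal (b m / real m + 0)"
      by (intro tendsto_intros tendsto_ennrealI lim_const_over_n)
    then have "\<forall>\<^sub>F n in sequentially. ennreal (b m / real m + real m * b 1 / real n) < l"
      by (rule order_tendstoD) (use m div in simp)
    then show "\<forall>\<^sub>F n in sequentially. a n / of_nat n < l"
      using eventually_ge_at_top[of 1]
    proof eventually_elim
      case (elim n)
      then show ?case using bound[of m n] m(1) by (simp add: div) (meson ennreal_leI le_less_trans)
    qed
  qed
qed


section \<open>Trajectories\<close>

lemma rmod_hom_image_set_add: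
  assumes "right_module R M" "right_module R N" "f \<in> rmod_hom R M N" "A \<subseteq> carrier M" "B \<subseteq> carrier M"
  shows "f ` (A <+>\<^bsub>M\<^esub> B) = f ` A <+>\<^bsub>N\<^esub> f ` B"
proof -
  have "f (a \<oplus>\<^bsub>M\<^esub> b) = f a \<oplus>\<^bsub>N\<^esub> f b" if "a \<in> A" "b \<in> B" for a b
    using that assms(4,5) by (intro rmod_hom_add[OF assms(3)]) auto
  then show ?thesis by (auto simp: set_add_def' image_UN)
qed

locale right_module_endo = right_module R M
  for R :: "('a, 'k) ring_scheme" (structure) and M :: "('a, 'b) rmod" +
  fixes \<phi> :: "'b \<Rightarrow> 'b"
  assumes endo: "\<phi> \<in> rmod_hom R M M"
begin

lemmas funpow_hom = rmod_hom_funpow[OF endo]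

lemmas rsubmodule_funpow_image = rmod_hom_image[OF right_module_axioms right_module_axioms funpow_hom]

lemma trajectory_0: "trajectory M \<phi> A 0 = {\<zero>\<^bsub>M\<^esub>}"
  by (simp add: trajectory_def)

text \<open>Splitting off the last summand turns the set of sums over all families into an iterated
  sum of submodules, on which the later inductions run.\<close>

lemma trajectory_Suc:
  assumes A: "A \<subseteq> carrier M"
  shows "trajectory M \<phi> A (Suc n) = trajectory M \<phi> A n <+>\<^bsub>M\<^esub> (\<phi> ^^ n) ` A"
proof -
  have cl: "x i \<in> carrier M" if x: "\<forall>i < n. x i \<in> (\<phi> ^^ i) ` A" "i < n" for x i n
  proof -
    obtain a where "a \<in> A" "x i = (\<phi> ^^ i) a" using x by auto
    then show ?thesis using A rmod_hom_closed[OF funpow_hom, of a i] by auto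
  qed
  have split: "(\<Oplus>\<^bsub>M\<^esub> i \<in> {..<Suc n}. x i) = (\<Oplus>\<^bsub>M\<^esub> i \<in> {..<n}. x i) \<oplus>\<^bsub>M\<^esub> x n"
    if "\<forall>i < Suc n. x i \<in> (\<phi> ^^ i) ` A" for x
    using cl[OF that] unfolding lessThan_Suc
    by (subst M.finsum_insert) (auto intro!: M.a_comm M.finsum_closed)
  show ?thesis
  proof (intro equalityI subsetI)
    fix z assume "z \<in> trajectory M \<phi> A (Suc n)"
    then obtain x where "z = (\<Oplus>\<^bsub>M\<^esub> i \<in> {..<Suc n}. x i)" "\<forall>i < Suc n. x i \<in> (\<phi> ^^ i) ` A"
      by (auto simp: trajectory_def)
    then show "z \<in> trajectory M \<phi> A n <+>\<^bsub>M\<^esub> (\<phi> ^^ n) ` A"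
      unfolding split[OF \<open>\<forall>i < Suc n. _ i\<close>] by (auto simp: trajectory_def intro!: set_addI)
  next
    fix z assume "z \<in> trajectory M \<phi> A n <+>\<^bsub>M\<^esub> (\<phi> ^^ n) ` A"
    then obtain y b where "y \<in> trajectory M \<phi> A n" and b: "b \<in> (\<phi> ^^ n) ` A" and z: "z = y \<oplus>\<^bsub>M\<^esub> b"
      by (rule set_addE)
    then obtain x where x: "y = (\<Oplus>\<^bsub>M\<^esub> i \<in> {..<n}. x i)" "\<forall>i < n. x i \<in> (\<phi> ^^ i) ` A"
      by (auto simp: trajectory_def)
    \<comment> \<open>Changing the family at the index \<open>n\<close> leaves the sum over the
      smaller indices as it was.\<close>
    let ?x = "x(n := b)"
    have x': "\<forall>i < Suc n. ?x i \<in> (\<phi> ^^ i) ` A" using x b by (auto simp: less_Suc_eq)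
    have "(\<Oplus>\<^bsub>M\<^esub> i \<in> {..<n}. ?x i) = y"
      unfolding x(1) by (rule M.finsum_cong') (use cl[OF x(2)] in auto)
    then have "z = (\<Oplus>\<^bsub>M\<^esub> i \<in> {..<Suc n}. ?x i)" using split[OF x'] z by simp
    then show "z \<in> trajectory M \<phi> A (Suc n)"
      using x' unfolding trajectory_def by blast
  qed
qed

lemma rsubmodule_trajectory:
  assumes "rsubmodule R A M"
  shows "rsubmodule R (trajectory M \<phi> A n) M"
  using trajectory_Suc[OF rsubmodule_subset[OF assms]]
  by (induction n)
    (simp_all add: trajectory_0 rsubmodule_trivial rsubmodule_set_add rsubmodule_funpow_image assms)

lemma trajectory_mono: "A \<subseteq> B \<Longrightarrow> trajectory M \<phi> A n \<subseteq> trajectory M \<phi> B n"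
  unfolding trajectory_def by blast

lemma set_add_trivial_left: "rsubmodule R A M \<Longrightarrow> {\<zero>\<^bsub>M\<^esub>} <+>\<^bsub>M\<^esub> A = A"
  using rsubmodule_zero[of R A M] rsubmodule_subset[of R A M] rsubmodule_trivial
  by (simp add: set_add_comm[of "{\<zero>\<^bsub>M\<^esub>}" A] set_add_absorb)

lemma trajectory_1: "rsubmodule R A M \<Longrightarrow> trajectory M \<phi> A 1 = A"
  by (simp add: trajectory_Suc[OF rsubmodule_subset] trajectory_0 set_add_trivial_left)

lemma set_add_assoc:
  "A \<subseteq> carrier M \<Longrightarrow> B \<subseteq> carrier M \<Longrightarrow> C \<subseteq> carrier M \<Longrightarrow>
    (A <+>\<^bsub>M\<^esub> B) <+>\<^bsub>M\<^esub> C = A <+>\<^bsub>M\<^esub> (B <+>\<^bsub>M\<^esub> C)"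
  using M.add.set_mult_assoc by (simp add: set_add_def)

text \<open>This gives the subadditivity of the lengths, and it compares the entropy of
  \<open>A\<close> with that of its images under powers of \<open>\<phi>\<close>.\<close>

lemma trajectory_add:
  assumes A: "rsubmodule R A M"
  shows "trajectory M \<phi> A (m + n)
    = trajectory M \<phi> A m <+>\<^bsub>M\<^esub> (\<phi> ^^ m) ` trajectory M \<phi> A n"
proof (induction n)
  case 0
  have "(\<phi> ^^ m) \<zero>\<^bsub>M\<^esub> = \<zero>\<^bsub>M\<^esub>"
    by (rule rmod_hom_zero[OF right_module_axioms right_module_axioms funpow_hom])
  then show ?case
    using rsubmodule_trajectory[OF A, of m] rsubmodule_trivial
    by (simp add: trajectory_0 set_add_absorb rsubmodule_zero)
next
  case (Suc n)
  note sub = rsubmodule_subset[OF rsubmodule_trajectory[OF A]]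
    rsubmodule_subset[OF rsubmodule_funpow_image[OF A]]
    rsubmodule_subset[OF rsubmodule_funpow_image[OF rsubmodule_trajectory[OF A]]]
    rsubmodule_subset[OF rsubmodule_funpow_image[OF rsubmodule_funpow_image[OF A]]]
  have "(\<phi> ^^ (m + n)) ` A = (\<phi> ^^ m) ` (\<phi> ^^ n) ` A"
    by (simp add: funpow_add image_comp)
  then show ?case
    by (simp add: trajectory_Suc[OF rsubmodule_subset[OF A]] Suc set_add_assoc sub
        rmod_hom_image_set_add[OF right_module_axioms right_module_axioms funpow_hom])
qed

text \<open>Used with the map into the localization and, for \<open>N = M\<close>, with the powers
  of \<open>\<phi>\<close> themselves.\<close>

lemma image_trajectory:
  assumes N: "right_module_endo R N \<psi>" and f: "f \<in> rmod_hom R M N"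
    and comm: "\<And>x. x \<in> carrier M \<Longrightarrow> f (\<phi> x) = \<psi> (f x)" and A: "rsubmodule R A M"
  shows "f ` trajectory M \<phi> A n = trajectory N \<psi> (f ` A) n"
proof -
  interpret N: right_module_endo R N \<psi> by fact
  have fA: "rsubmodule R (f ` A) N"
    by (rule rmod_hom_image[OF right_module_axioms N.right_module_axioms f A])
  have pow: "f ((\<phi> ^^ n) x) = (\<psi> ^^ n) (f x)" if "x \<in> carrier M" for x n
    using that by (induction n) (simp_all add: comm rmod_hom_closed[OF funpow_hom])
  then have powA: "f ` (\<phi> ^^ n) ` A = (\<psi> ^^ n) ` f ` A" for n
    unfolding image_image using rsubmodule_subset[OF A] by (intro image_cong pow refl) auto
  show ?thesis
  proof (induction n)
    case 0
    then show ?case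
      by (simp add: trajectory_0 N.trajectory_0 rmod_hom_zero[OF right_module_axioms N.right_module_axioms f])
  next
    case (Suc n)
    show ?case
      by (simp add: trajectory_Suc[OF rsubmodule_subset[OF A]] N.trajectory_Suc[OF rsubmodule_subset[OF fA]]
          rmod_hom_image_set_add[OF right_module_axioms N.right_module_axioms f]
          rsubmodule_subset[OF rsubmodule_trajectory[OF A]] powA Suc
          rsubmodule_subset[OF rsubmodule_funpow_image[OF A]])
  qed
qed

lemma funpow_image_trajectory:
  assumes A: "rsubmodule R A M"
  shows "(\<phi> ^^ m) ` trajectory M \<phi> A n = trajectory M \<phi> ((\<phi> ^^ m) ` A) n"
  by (rule image_trajectory[OF right_module_endo_axioms funpow_hom _ A]) (simp add: funpow_swap1)

end


section \<open>Entropy\<close>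

locale length_endo = length_fun R L + right_module_endo R M \<phi>
  for R :: "('a, 'k) ring_scheme" (structure)
    and L :: "('a, 'u) rmod \<Rightarrow> ennreal" and M :: "('a, 'u) rmod" and \<phi> :: "'u \<Rightarrow> 'u"
begin

abbreviation len :: "'u set \<Rightarrow> ennreal" where "len A \<equiv> L (M\<lparr>carrier := A\<rparr>)"

lemma length_trajectory_add_le:
  assumes A: "rsubmodule R A M"
  shows "len (trajectory M \<phi> A (m + n)) \<le> len (trajectory M \<phi> A m) + len (trajectory M \<phi> A n)"
  unfolding trajectory_add[OF A]
  by (rule order_trans[OF length_set_add_le add_left_mono])
    (auto intro!: right_module_axioms rsubmodule_trajectory[OF A] rsubmodule_funpow_image
      length_image_le funpow_hom)

lemma length_trajectory_finite:
  assumes A: "A \<in> Fin_L R L M"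
  shows "len (trajectory M \<phi> A n) < \<infinity>"
proof (induction n)
  case 0
  have "len {\<zero>\<^bsub>M\<^esub>} = 0"
    by (rule length_trivial[OF rsubmodule_right_module[OF rsubmodule_trivial]]) simp
  then show ?case by (simp add: trajectory_0)
next
  case (Suc n)
  have A': "rsubmodule R A M" "len A < \<infinity>" using A by (auto simp: Fin_L_def)
  have "len (trajectory M \<phi> A (n + 1)) \<le> len (trajectory M \<phi> A n) + len A"
    using length_trajectory_add_le[OF A'(1), of n 1] by (simp only: trajectory_1[OF A'(1)])
  also have "\<dots> < \<infinity>" using Suc A'(2) by simp
  finally show ?case by simp
qed

text \<open>The definition of \<open>ent_at\<close> takes \<open>lim\<close>, which is meaningful
  only if the limit exists; subadditivity and finiteness supply existence. The infimum form bounds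
  the length of every single trajectory from below.\<close>

lemma ent_at_tendsto:
  assumes A: "A \<in> Fin_L R L M"
  shows "(\<lambda>n. len (trajectory M \<phi> A n) / of_nat n) \<longlonglongrightarrow> ent_at L M \<phi> A" (is ?lim)
    and "ent_at L M \<phi> A = (INF n\<in>{1..}. len (trajectory M \<phi> A n) / of_nat n)" (is ?eq)
proof -
  have A': "rsubmodule R A M" using A by (simp add: Fin_L_def)
  have "len (trajectory M \<phi> A 0) = 0"
    unfolding trajectory_0
    by (rule length_trivial[OF rsubmodule_right_module[OF rsubmodule_trivial]]) simp
  from subadditive_tendsto_INF[OF length_trajectory_add_le[OF A'] this length_trajectory_finite[OF A]]
  have *: "(\<lambda>n. len (trajectory M \<phi> A n) / of_nat n)
      \<longlonglongrightarrow> (INF n\<in>{1..}. len (trajectory M \<phi> A n) / of_nat n)" .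
  show ?eq unfolding ent_at_def by (rule limI[OF *])
  with * show ?lim by simp
qed

lemma ent_at_le:
  assumes "A \<in> Fin_L R L M" "n \<ge> 1"
  shows "of_nat n * ent_at L M \<phi> A \<le> len (trajectory M \<phi> A n)"
proof -
  have "of_nat n * ent_at L M \<phi> A \<le> of_nat n * (len (trajectory M \<phi> A n) / of_nat n)"
    unfolding ent_at_tendsto(2)[OF assms(1)] using assms(2) by (intro mult_left_mono INF_lower) auto
  also have "\<dots> = len (trajectory M \<phi> A n)"
    using assms(2) ennreal_mult_divide_eq[of "of_nat n" "len (trajectory M \<phi> A n)"]
    by (simp add: ennreal_times_divide mult.commute[of "of_nat n"])
  finally show ?thesis .
qed

lemma Fin_L_funpow_image: "A \<in> Fin_L R L M \<Longrightarrow> (\<phi> ^^ m) ` A \<in> Fin_L R L M"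
  using length_image_le[OF right_module_axioms right_module_axioms funpow_hom]
  by (auto simp: Fin_L_def rsubmodule_funpow_image intro: le_less_trans)

text \<open>Up to the fixed summand \<open>T_m A\<close>, whose finite length disappears after
  division by \<open>n\<close>, every trajectory of \<open>A\<close> lies in the corresponding
  trajectory of \<open>\<phi>^m A\<close>.\<close>

lemma ent_at_funpow_image_ge:
  assumes A: "A \<in> Fin_L R L M"
  shows "ent_at L M \<phi> A \<le> ent_at L M \<phi> ((\<phi> ^^ m) ` A)"
proof (rule LIMSEQ_le)
  have A': "rsubmodule R A M" using A by (simp add: Fin_L_def)
  let ?c = "len (trajectory M \<phi> A m)"
  show "(\<lambda>n. len (trajectory M \<phi> A n) / of_nat n) \<longlonglongrightarrow> ent_at L M \<phi> A"
    by (rule ent_at_tendsto[OF A])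
  show "(\<lambda>n. ?c / of_nat n + len (trajectory M \<phi> ((\<phi> ^^ m) ` A) n) / of_nat n)
      \<longlonglongrightarrow> ent_at L M \<phi> ((\<phi> ^^ m) ` A)"
    using tendsto_add[OF ennreal_const_over_n_tendsto_0[OF length_trajectory_finite[OF A]]
        ent_at_tendsto(1)[OF Fin_L_funpow_image[OF A]]] by simp
  have "len (trajectory M \<phi> A n) \<le> ?c + len (trajectory M \<phi> ((\<phi> ^^ m) ` A) n)" for n
  proof -
    have T: "rsubmodule R (trajectory M \<phi> A k) M" for k by (rule rsubmodule_trajectory[OF A'])
    \<comment> \<open>The trajectory of length \<open>n + m\<close> is split in two ways: after
      \<open>n\<close> steps to see that it contains \<open>T_n A\<close>, and after
      \<open>m\<close> steps to isolate the trajectory of \<open>\<phi>^m A\<close>.\<close>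
    have "trajectory M \<phi> A n \<subseteq> trajectory M \<phi> A (n + m)"
      unfolding trajectory_add[OF A'] by (intro set_add_upper1 T rsubmodule_funpow_image)
    then have "len (trajectory M \<phi> A n) \<le> len (trajectory M \<phi> A (m + n))"
      by (intro length_mono[OF right_module_axioms] T) (simp add: add.commute)
    also have "\<dots> \<le> ?c + len (trajectory M \<phi> ((\<phi> ^^ m) ` A) n)"
      unfolding trajectory_add[OF A'] funpow_image_trajectory[OF A', symmetric]
      by (intro length_set_add_le right_module_axioms T rsubmodule_funpow_image)
    finally show ?thesis .
  qed
  then show "\<exists>N. \<forall>n\<ge>N. len (trajectory M \<phi> A n) / of_nat n
      \<le> ?c / of_nat n + len (trajectory M \<phi> ((\<phi> ^^ m) ` A) n) / of_nat n"
    by (auto simp: divide_right_mono_ennreal simp flip: add_divide_distrib_ennreal)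
qed

text \<open>The excess of \<open>A\<close> over \<open>B\<close> cannot grow when \<open>C\<close>
  is added to both. Apply the modular law to \<open>X = C + B\<close> and \<open>A\<close>: their
  sum is \<open>C + A\<close>, and their intersection contains \<open>B\<close>.\<close>

lemma length_set_add_approx:
  assumes A: "rsubmodule R A M" and B: "rsubmodule R B M" and C: "rsubmodule R C M" and "B \<subseteq> A"
    and fin: "len B < \<infinity>" and c: "len A \<le> len B + c"
  shows "len (C <+>\<^bsub>M\<^esub> A) \<le> len (C <+>\<^bsub>M\<^esub> B) + c"
proof -
  let ?X = "C <+>\<^bsub>M\<^esub> B"
  have X: "rsubmodule R ?X M" by (rule rsubmodule_set_add[OF C B])
  note sub = rsubmodule_subset[OF A] rsubmodule_subset[OF B] rsubmodule_subset[OF C]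
  have "B \<subseteq> ?X"
    using set_add_upper1[OF B C] set_add_comm[OF sub(2,3)] by simp
  then have le: "len B \<le> len (?X \<inter> A)"
    using \<open>B \<subseteq> A\<close> by (intro length_mono[OF right_module_axioms B rsubmodule_Int[OF X A]]) auto
  have "?X <+>\<^bsub>M\<^esub> A = C <+>\<^bsub>M\<^esub> (A <+>\<^bsub>M\<^esub> B)"
    by (simp add: set_add_assoc sub set_add_comm[of B A])
  then have "?X <+>\<^bsub>M\<^esub> A = C <+>\<^bsub>M\<^esub> A" by (simp add: set_add_absorb[OF A B \<open>B \<subseteq> A\<close>])
  then have modular: "len (C <+>\<^bsub>M\<^esub> A) + len (?X \<inter> A) = len ?X + len A"
    using length_modular[OF right_module_axioms X A] by simp
  \<comment> \<open>Both ends of the estimate are arranged to contain \<open>len B\<close>, whose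
    finiteness permits cancellation.\<close>
  have "len B + len (C <+>\<^bsub>M\<^esub> A) \<le> len (C <+>\<^bsub>M\<^esub> A) + len (?X \<inter> A)"
    using add_right_mono[OF le] by (simp add: add.commute)
  also have "\<dots> \<le> len ?X + (len B + c)"
    unfolding modular by (rule add_left_mono[OF c])
  also have "\<dots> = len B + (len ?X + c)" by (simp add: ac_simps)
  finally show ?thesis using fin by (auto simp: ennreal_add_left_cancel_le)
qed

lemma inj_on_funpow:
  assumes inj: "inj_on \<phi> (carrier M)"
  shows "inj_on (\<phi> ^^ n) (carrier M)"
proof (induction n)
  case (Suc n)
  have "inj_on \<phi> ((\<phi> ^^ n) ` carrier M)"
    by (rule inj_on_subset[OF inj]) (use rmod_hom_closed[OF funpow_hom] in auto)
  then show ?case using comp_inj_on[OF Suc, of \<phi>] by (simp add: comp_def)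
qed simp

text \<open>The summands \<open>\<phi>^i A\<close> are replaced by \<open>\<phi>^i B\<close> one at
  a time. Injectivity preserves lengths, so each replacement starts from the same excess
  \<open>c\<close> and costs at most that.\<close>

lemma length_trajectory_approx:
  assumes inj: "inj_on \<phi> (carrier M)" and A: "rsubmodule R A M" and B: "rsubmodule R B M"
    and "B \<subseteq> A" and fin: "len B < \<infinity>" and c: "len A \<le> len B + c"
  shows "len (trajectory M \<phi> A n) \<le> len (trajectory M \<phi> B n) + of_nat n * c"
proof -
  note len_pow = length_inj_image[OF right_module_axioms right_module_axioms funpow_hom _ inj_on_funpow[OF inj]]
  \<comment> \<open>The extra summand \<open>C\<close> holds the terms that are not being replaced
    at the moment, so that the induction can move \<open>\<phi>^n A\<close> into it; the claim is
    the case \<open>C = 0\<close>.\<close>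
  have "len (C <+>\<^bsub>M\<^esub> trajectory M \<phi> A n) \<le> len (C <+>\<^bsub>M\<^esub> trajectory M \<phi> B n) + of_nat n * c"
    if "rsubmodule R C M" for C
    using that
  proof (induction n arbitrary: C)
    case (Suc n)
    let ?A = "(\<phi> ^^ n) ` A" and ?B = "(\<phi> ^^ n) ` B"
      and ?TA = "trajectory M \<phi> A n" and ?TB = "trajectory M \<phi> B n"
    have s: "rsubmodule R ?A M" "rsubmodule R ?B M" "rsubmodule R ?TA M" "rsubmodule R ?TB M"
      by (auto intro!: rsubmodule_trajectory rsubmodule_funpow_image A B)
    note sub = s[THEN rsubmodule_subset] rsubmodule_subset[OF Suc.prems]
    have "len (C <+>\<^bsub>M\<^esub> trajectory M \<phi> A (Suc n)) = len ((C <+>\<^bsub>M\<^esub> ?A) <+>\<^bsub>M\<^esub> ?TA)"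
      by (simp add: trajectory_Suc[OF rsubmodule_subset[OF A]] set_add_assoc sub set_add_comm[of ?TA])
    also have "\<dots> \<le> len ((C <+>\<^bsub>M\<^esub> ?A) <+>\<^bsub>M\<^esub> ?TB) + of_nat n * c"
      by (intro Suc.IH rsubmodule_set_add Suc.prems s)
    also have "(C <+>\<^bsub>M\<^esub> ?A) <+>\<^bsub>M\<^esub> ?TB = (C <+>\<^bsub>M\<^esub> ?TB) <+>\<^bsub>M\<^esub> ?A"
      by (simp add: set_add_assoc sub set_add_comm[of ?TB])
    also have "len \<dots> \<le> len ((C <+>\<^bsub>M\<^esub> ?TB) <+>\<^bsub>M\<^esub> ?B) + c"
      using \<open>B \<subseteq> A\<close> fin c
      by (intro length_set_add_approx s rsubmodule_set_add Suc.prems)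
        (auto simp: len_pow A B)
    also have "(C <+>\<^bsub>M\<^esub> ?TB) <+>\<^bsub>M\<^esub> ?B = C <+>\<^bsub>M\<^esub> trajectory M \<phi> B (Suc n)"
      by (simp add: trajectory_Suc[OF rsubmodule_subset[OF B]] set_add_assoc sub)
    finally show ?case by (simp add: distrib_right add_ac add_mono)
  qed (simp add: trajectory_0)
  from this[OF rsubmodule_trivial] show ?thesis
    by (simp add: set_add_trivial_left rsubmodule_trajectory A B)
qed

end


section \<open>Entropy of a localization\<close>

text \<open>The hypotheses on \<open>f\<close>, \<open>\<psi>\<close> say that \<open>N\<close> is the localization of \<open>M\<close> at \<open>\<phi>\<close>.\<close>

locale length_localization =
  M: length_endo R L M \<phi> + N: length_endo R L N \<psi>
  for R :: "('a, 'k) ring_scheme" (structure) and L :: "('a, 'u) rmod \<Rightarrow> ennreal"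
    and M N :: "('a, 'u) rmod" and \<phi> \<psi> :: "'u \<Rightarrow> 'u" +
  fixes f :: "'u \<Rightarrow> 'u"
  assumes f_hom: "f \<in> rmod_hom R M N"
    and f_comm: "\<And>x. x \<in> carrier M \<Longrightarrow> f (\<phi> x) = \<psi> (f x)"
    and \<psi>_inj: "inj_on \<psi> (carrier N)"
    and f_kernel: "\<And>x. x \<in> carrier M \<Longrightarrow> f x = \<zero>\<^bsub>N\<^esub> \<Longrightarrow> \<exists>k. (\<phi> ^^ k) x = \<zero>\<^bsub>M\<^esub>"
    and f_exhaust: "\<And>y. y \<in> carrier N \<Longrightarrow> \<exists>k. (\<psi> ^^ k) y \<in> f ` carrier M"
begin

lemmas f_closed = rmod_hom_closed[OF f_hom]
lemmas f_zero = rmod_hom_zero[OF M.right_module_axioms N.right_module_axioms f_hom]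
lemmas rsubmodule_image = rmod_hom_image[OF M.right_module_axioms N.right_module_axioms f_hom]

lemma image_trajectory:
  "rsubmodule R A M \<Longrightarrow> f ` trajectory M \<phi> A n = trajectory N \<psi> (f ` A) n"
  by (rule M.image_trajectory[OF N.right_module_endo_axioms f_hom f_comm])

lemma funpow_inj: "inj_on (\<psi> ^^ k) (carrier N)"
  by (rule N.inj_on_funpow[OF \<psi>_inj])

lemma f_funpow: "x \<in> carrier M \<Longrightarrow> f ((\<phi> ^^ k) x) = (\<psi> ^^ k) (f x)"
  by (induction k) (simp_all add: f_comm rmod_hom_closed[OF M.funpow_hom])

lemma f_eq_zero_iff:
  assumes x: "x \<in> carrier M"
  shows "f x = \<zero>\<^bsub>N\<^esub> \<longleftrightarrow> (\<exists>k. (\<phi> ^^ k) x = \<zero>\<^bsub>M\<^esub>)"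
proof
  assume "\<exists>k. (\<phi> ^^ k) x = \<zero>\<^bsub>M\<^esub>"
  then obtain k where "(\<phi> ^^ k) x = \<zero>\<^bsub>M\<^esub>" by blast
  then have "(\<psi> ^^ k) (f x) = (\<psi> ^^ k) \<zero>\<^bsub>N\<^esub>"
    using f_funpow[OF x, of k] f_zero
      rmod_hom_zero[OF N.right_module_axioms N.right_module_axioms N.funpow_hom] by simp
  then show "f x = \<zero>\<^bsub>N\<^esub>"
    using inj_onD[OF funpow_inj] f_closed[OF x] by blast
qed (rule f_kernel[OF x])

text \<open>\<open>f\<close> shortens a trajectory by the length of its part in the kernel of
  \<open>f\<close>, which is the supremum of the losses under the powers \<open>\<phi>^m\<close>. No
  loss of the latter kind lowers the entropy, so the same lower bound holds after applying
  \<open>f\<close>.\<close>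

lemma ent_at_le_image:
  assumes A: "A \<in> Fin_L R L M"
  shows "ent_at L M \<phi> A \<le> ent_at L N \<psi> (f ` A)" and "f ` A \<in> Fin_L R L N"
proof -
  have A': "rsubmodule R A M" "M.len A < \<infinity>" using A by (auto simp: Fin_L_def)
  show fA: "f ` A \<in> Fin_L R L N"
    using A'
      M.length_image_le[OF M.right_module_axioms N.right_module_axioms f_hom A'(1)]
    by (auto simp: Fin_L_def rsubmodule_image intro: le_less_trans)
  let ?e = "ent_at L M \<phi> A"
  have "?e \<le> N.len (trajectory N \<psi> (f ` A) n) / of_nat n" if n: "n \<ge> 1" for n
  proof -
    define B where "B = trajectory M \<phi> A n"
    \<comment> \<open>These kernels of the powers of \<open>\<phi>\<close> on \<open>B\<close>
      increase to the kernel of \<open>f\<close> on \<open>B\<close>, so \<open>s\<close> is the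
      length lost under \<open>f\<close>.\<close>
    define C where "C m = {x \<in> B. (\<phi> ^^ m) x = \<zero>\<^bsub>M\<^esub>}" for m
    define s where "s = (SUP m. M.len (C m))"
    have B: "rsubmodule R B M" unfolding B_def by (rule M.rsubmodule_trajectory[OF A'(1)])
    have finB: "M.len B < \<infinity>" unfolding B_def by (rule M.length_trajectory_finite[OF A])
    have C: "rsubmodule R (C m) M" for m
      using rmod_hom_vimage[OF M.right_module_axioms M.right_module_axioms M.funpow_hom B
          M.rsubmodule_trivial] by (simp add: C_def)
    have "\<phi> \<zero>\<^bsub>M\<^esub> = \<zero>\<^bsub>M\<^esub>"
      by (rule rmod_hom_zero[OF M.right_module_axioms M.right_module_axioms M.endo])
    then have "incseq C" by (intro incseq_SucI) (auto simp: C_def)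
    have "{x \<in> B. f x = \<zero>\<^bsub>N\<^esub>} = (\<Union>m. C m)"
      using rsubmodule_subset[OF B] by (auto simp: C_def f_eq_zero_iff subset_iff)
    then have len_B: "M.len B = s + N.len (f ` B)"
      unfolding s_def using M.length_kernel_image[OF M.right_module_axioms N.right_module_axioms f_hom B]
        M.length_Union_chain[OF M.right_module_axioms C \<open>incseq C\<close>] by simp
    have "s + of_nat n * ?e \<le> M.len B"
    proof -
      have "M.len (C m) + of_nat n * ?e \<le> M.len B" for m
      proof -
        \<comment> \<open>What is left after the loss of \<open>C m\<close> is the trajectory of
          \<open>\<phi>^m A\<close>, whose length is bounded below by its own entropy and hence by
          that of \<open>A\<close>.\<close>
        have "of_nat n * ?e \<le> of_nat n * ent_at L M \<phi> ((\<phi> ^^ m) ` A)"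
          by (intro mult_left_mono M.ent_at_funpow_image_ge A) simp
        also have "\<dots> \<le> M.len ((\<phi> ^^ m) ` B)"
          unfolding B_def M.funpow_image_trajectory[OF A'(1)]
          by (rule M.ent_at_le[OF M.Fin_L_funpow_image[OF A] n])
        finally show ?thesis
          using M.length_kernel_image[OF M.right_module_axioms M.right_module_axioms M.funpow_hom[of m] B]
          by (simp add: C_def add_left_mono)
      qed
      then show ?thesis
        unfolding s_def by (subst ennreal_SUP_add_left[symmetric]) (auto intro!: SUP_least)
    qed
    then have "s + of_nat n * ?e \<le> s + N.len (f ` B)" by (simp add: len_B)
    \<comment> \<open>Finiteness of \<open>s\<close> allows its cancellation in the extended
      reals.\<close>
    moreover have "s \<noteq> \<infinity>" using len_B finB by auto
    ultimately have "of_nat n * ?e \<le> N.len (f ` B)"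
      by (simp add: ennreal_add_left_cancel_le)
    then have "of_nat n * ?e / of_nat n \<le> N.len (f ` B) / of_nat n"
      by (rule divide_right_mono_ennreal)
    then show ?thesis
      using n ennreal_mult_divide_eq[of "of_nat n" ?e]
      by (simp add: B_def image_trajectory[OF A'(1)] mult.commute)
  qed
  then show "?e \<le> ent_at L N \<psi> (f ` A)"
    unfolding N.ent_at_tendsto(2)[OF fA] by (auto intro!: INF_greatest)
qed

text \<open>Each element enters the image of \<open>f\<close> after some power of
  \<open>\<psi>\<close> and stays there, because \<open>\<psi> (f x) = f (\<phi> x)\<close>;
  finitely many elements therefore share an exponent.\<close>

lemma finite_subset_pullback:
  assumes "finite S" "S \<subseteq> carrier N"
  obtains k S' where "finite S'" "S' \<subseteq> carrier M" "(\<psi> ^^ k) ` S = f ` S'"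
proof -
  define C where "C k = {y \<in> carrier N. (\<psi> ^^ k) y \<in> f ` carrier M}" for k
  have "incseq C"
  proof (rule incseq_SucI, rule subsetI)
    fix k y assume "y \<in> C k"
    then obtain x where "y \<in> carrier N" "x \<in> carrier M" "(\<psi> ^^ k) y = f x" by (auto simp: C_def)
    then show "y \<in> C (Suc k)"
      using rmod_hom_closed[OF M.endo] by (auto simp: C_def f_comm[symmetric])
  qed
  moreover have "S \<subseteq> (\<Union>k. C k)" using assms(2) f_exhaust by (auto simp: C_def)
  ultimately obtain k where k: "S \<subseteq> C k" using finite_subset_incseq[OF assms(1)] by metis
  have "(\<psi> ^^ k) ` S \<subseteq> f ` carrier M" using k by (auto simp: C_def)
  from finite_subset_image[OF finite_imageI[OF assms(1)] this] show thesis
    using that by metis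
qed

lemma ent_at_le_ent:
  assumes fin: "locally_L_finite R L M" and H: "H \<in> Fin_L R L N"
  shows "ent_at L N \<psi> H \<le> ent R L M \<phi>"
proof (rule ennreal_le_epsilon)
  fix c :: real assume c: "c > 0"
  have H': "rsubmodule R H N" "N.len H < \<infinity>" using H by (auto simp: Fin_L_def)
  let ?H = "N\<lparr>carrier := H\<rparr>"
  interpret H: right_module R ?H by (rule N.rsubmodule_right_module[OF H'(1)])
  let ?fg = "{F. fg_rsubmodule R F ?H}"
  \<comment> \<open>\<open>SUP_approx_ennreal\<close> asks for a nonempty index set; the span of the
    empty set belongs to it.\<close>
  have "fg_rsubmodule R (rspan R ?H {}) ?H" by (auto simp: fg_rsubmodule_def)
  then have ne: "?fg \<noteq> {}" by blast
  \<comment> \<open>By upper continuity a finitely generated \<open>K\<close> takes up all of the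
    length of \<open>H\<close> except for less than \<open>c\<close>.\<close>
  have "\<exists>K\<in>?fg. N.len H < L (?H\<lparr>carrier := K\<rparr>) + ennreal c"
    using H'(2) c
    by (intro SUP_approx_ennreal[OF _ ne M.length_continuous[OF H.right_module_axioms]]) auto
  then obtain K where K: "fg_rsubmodule R K ?H" "N.len H < N.len K + ennreal c" by auto
  then obtain S where S: "finite S" "S \<subseteq> H" "K = rspan R ?H S" by (auto simp: fg_rsubmodule_def)
  have KN: "rsubmodule R K N" "K \<subseteq> H"
    using N.rsubmodule_restrict_iff[OF H'(1)] H.rsubmodule_rspan[of S] S by auto
  have Kfin: "N.len K < \<infinity>"
    using M.length_mono[OF N.right_module_axioms KN(1) H'(1) KN(2)] H'(2) by (rule le_less_trans)
  have "S \<subseteq> carrier N" using S(2) rsubmodule_subset[OF H'(1)] by blast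
  then obtain k S' where S': "finite S'" "S' \<subseteq> carrier M" "(\<psi> ^^ k) ` S = f ` S'"
    using finite_subset_pullback S(1) by metis
  define F where "F = rspan R M S'"
  have F: "rsubmodule R F M" unfolding F_def by (rule M.rsubmodule_rspan[OF S'(2)])
  have "fg_rsubmodule R F M" using S' by (auto simp: fg_rsubmodule_def F_def)
  then have Ffin: "F \<in> Fin_L R L M"
    using fin F by (auto simp: locally_L_finite_def Fin_L_def)
  have fF: "rsubmodule R (f ` F) N" by (rule rsubmodule_image[OF F])
  \<comment> \<open>The elements of \<open>H\<close> carried into \<open>f F\<close> form a
    submodule, so it is enough to check the generators of \<open>K\<close>.\<close>
  have "K \<subseteq> {y \<in> H. (\<psi> ^^ k) y \<in> f ` F}"
    unfolding S(3)
  proof (rule H.rspan_minimal)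
    show "rsubmodule R {y \<in> H. (\<psi> ^^ k) y \<in> f ` F} ?H"
      using rmod_hom_vimage[OF N.right_module_axioms N.right_module_axioms N.funpow_hom H'(1) fF]
      by (auto simp: N.rsubmodule_restrict_iff[OF H'(1)])
    have "(\<psi> ^^ k) ` S \<subseteq> f ` F"
      unfolding S'(3) F_def by (intro image_mono M.rspan_superset)
    then show "S \<subseteq> {y \<in> H. (\<psi> ^^ k) y \<in> f ` F}" using S(2) by auto
  qed
  then have KF: "(\<psi> ^^ k) ` K \<subseteq> f ` F" by auto
  \<comment> \<open>Pass from \<open>H\<close> to \<open>K\<close> at cost \<open>c\<close> per
    summand, from \<open>K\<close> to its image under the length preserving \<open>\<psi>^k\<close>,
    into \<open>f F\<close> by monotonicity, and back to \<open>F\<close> since \<open>f\<close>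
    does not increase lengths.\<close>
  have le: "N.len (trajectory N \<psi> H n) \<le> M.len (trajectory M \<phi> F n) + of_nat n * ennreal c" for n
  proof -
    have T: "rsubmodule R (trajectory N \<psi> K n) N" by (rule N.rsubmodule_trajectory[OF KN(1)])
    have "N.len (trajectory N \<psi> H n) \<le> N.len (trajectory N \<psi> K n) + of_nat n * ennreal c"
      using N.length_trajectory_approx[OF \<psi>_inj H'(1) KN Kfin] K(2) by simp
    also have "N.len (trajectory N \<psi> K n) = N.len (trajectory N \<psi> ((\<psi> ^^ k) ` K) n)"
      using M.length_inj_image[OF N.right_module_axioms N.right_module_axioms N.funpow_hom T funpow_inj]
        N.funpow_image_trajectory[OF KN(1)] by simp
    also have "\<dots> \<le> N.len (trajectory N \<psi> (f ` F) n)"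
      by (intro M.length_mono[OF N.right_module_axioms] N.rsubmodule_trajectory
          N.rsubmodule_funpow_image KN(1) fF N.trajectory_mono KF)
    also have "\<dots> \<le> M.len (trajectory M \<phi> F n)"
      unfolding image_trajectory[OF F, symmetric]
      by (intro M.length_image_le[OF M.right_module_axioms N.right_module_axioms f_hom]
          M.rsubmodule_trajectory F)
    finally show ?thesis by (simp add: add_right_mono)
  qed
  have "ent_at L N \<psi> H \<le> ent_at L M \<phi> F + ennreal c"
  proof (rule LIMSEQ_le)
    show "(\<lambda>n. N.len (trajectory N \<psi> H n) / of_nat n) \<longlonglongrightarrow> ent_at L N \<psi> H"
      by (rule N.ent_at_tendsto[OF H])
    show "(\<lambda>n. M.len (trajectory M \<phi> F n) / of_nat n + ennreal c)
        \<longlonglongrightarrow> ent_at L M \<phi> F + ennreal c"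
      by (intro tendsto_intros M.ent_at_tendsto(1)[OF Ffin])
    have "N.len (trajectory N \<psi> H n) / of_nat n \<le> M.len (trajectory M \<phi> F n) / of_nat n + ennreal c"
      if "n \<ge> 1" for n
    proof -
      have "N.len (trajectory N \<psi> H n) / of_nat n
          \<le> (M.len (trajectory M \<phi> F n) + ennreal c * of_nat n) / of_nat n"
        using le by (intro divide_right_mono_ennreal) (simp add: mult.commute)
      then show ?thesis
        using that ennreal_mult_divide_eq[of "of_nat n" "ennreal c"]
        by (simp add: add_divide_distrib_ennreal)
    qed
    then show "\<exists>N0. \<forall>n\<ge>N0. N.len (trajectory N \<psi> H n) / of_nat n
        \<le> M.len (trajectory M \<phi> F n) / of_nat n + ennreal c" by blast
  qed
  also have "ent_at L M \<phi> F \<le> ent R L M \<phi>"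
    unfolding ent_def by (rule SUP_upper[OF Ffin])
  finally show "ent_at L N \<psi> H \<le> ent R L M \<phi> + ennreal c" by (simp add: add_right_mono)
qed

lemma ent_eq:
  assumes "locally_L_finite R L M"
  shows "ent R L M \<phi> = ent R L N \<psi>"
proof (rule antisym)
  show "ent R L M \<phi> \<le> ent R L N \<psi>"
    unfolding ent_def
    by (intro SUP_least) (blast intro: SUP_upper2 ent_at_le_image)
  show "ent R L N \<psi> \<le> ent R L M \<phi>"
    unfolding ent_def[of R L N] by (intro SUP_least ent_at_le_ent assms)
qed

end


section \<open>Base change\<close>

text \<open>The closure assumptions keep every defining relation inside the free abelian group, so
  that the relations generate a subgroup of it. Polynomials, Laurent polynomials and
  \<open>M_\<phi>\<close> are substituted later.\<close>

locale base_change_setup = T?: ring T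
  for S :: "('s, 'k) ring_scheme" and T :: "('t, 'l) ring_scheme" (structure)
    and \<iota> :: "'s \<Rightarrow> 't" and A :: "('s, 'b) rmod" +
  assumes \<iota>_closed: "s \<in> carrier S \<Longrightarrow> \<iota> s \<in> carrier T"
    and A_add_closed: "a \<in> carrier A \<Longrightarrow> a' \<in> carrier A \<Longrightarrow> a \<oplus>\<^bsub>A\<^esub> a' \<in> carrier A"
    and A_ract_closed: "a \<in> carrier A \<Longrightarrow> s \<in> carrier S \<Longrightarrow> a \<lhd>\<^bsub>A\<^esub> s \<in> carrier A"
begin

abbreviation "G \<equiv> free_Abelian_group (carrier A \<times> carrier T)"
abbreviation "Rel \<equiv> tensor_relations S T \<iota> A"
abbreviation "H \<equiv> generate G Rel"
abbreviation "B \<equiv> base_change S T \<iota> A"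
abbreviation "cls f \<equiv> H #>\<^bsub>G\<^esub> f"

sublocale G: comm_group G by (rule abelian_free_Abelian_group)

lemma relation_add_left:
  "\<lbrakk>a \<in> carrier A; a' \<in> carrier A; b \<in> carrier T\<rbrakk>
    \<Longrightarrow> frag_of (a \<oplus>\<^bsub>A\<^esub> a', b) - frag_of (a, b) - frag_of (a', b) \<in> Rel"
  unfolding tensor_relations_def by blast

lemma relation_add_right:
  "\<lbrakk>a \<in> carrier A; b \<in> carrier T; b' \<in> carrier T\<rbrakk>
    \<Longrightarrow> frag_of (a, b \<oplus>\<^bsub>T\<^esub> b') - frag_of (a, b) - frag_of (a, b') \<in> Rel"
  unfolding tensor_relations_def by blast

lemma relation_balanced:
  "\<lbrakk>a \<in> carrier A; s \<in> carrier S; b \<in> carrier T\<rbrakk>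
    \<Longrightarrow> frag_of (a \<lhd>\<^bsub>A\<^esub> s, b) - frag_of (a, \<iota> s \<otimes>\<^bsub>T\<^esub> b) \<in> Rel"
  unfolding tensor_relations_def by blast

lemma relation_cases:
  assumes "f \<in> Rel"
  obtains (add_left) a a' b where "a \<in> carrier A" "a' \<in> carrier A" "b \<in> carrier T"
      "f = frag_of (a \<oplus>\<^bsub>A\<^esub> a', b) - frag_of (a, b) - frag_of (a', b)"
    | (add_right) a b b' where "a \<in> carrier A" "b \<in> carrier T" "b' \<in> carrier T"
      "f = frag_of (a, b \<oplus>\<^bsub>T\<^esub> b') - frag_of (a, b) - frag_of (a, b')"
    | (balanced) a s b where "a \<in> carrier A" "s \<in> carrier S" "b \<in> carrier T"
      "f = frag_of (a \<lhd>\<^bsub>A\<^esub> s, b) - frag_of (a, \<iota> s \<otimes>\<^bsub>T\<^esub> b)"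
  using assms unfolding tensor_relations_def
  by (elim UnE CollectE exE conjE) ((rule add_left add_right balanced; assumption)+)

lemma frag_of_closed: "a \<in> carrier A \<Longrightarrow> b \<in> carrier T \<Longrightarrow> frag_of (a, b) \<in> carrier G"
  by simp

lemma add_closed: "x \<in> carrier G \<Longrightarrow> y \<in> carrier G \<Longrightarrow> x + y \<in> carrier G"
  using G.m_closed[of x y] by simp

lemma diff_closed: "x \<in> carrier G \<Longrightarrow> y \<in> carrier G \<Longrightarrow> x - y \<in> carrier G"
  using keys_diff[of x y] by auto

lemma relations_subset: "Rel \<subseteq> carrier G"
  by (auto elim!: relation_cases intro!: diff_closed frag_of_closed A_add_closed A_ract_closed \<iota>_closed
      simp del: carrier_free_Abelian_group_iff)

lemma free_induct [consumes 1, case_names zero diff frag_of]: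
  assumes "f \<in> carrier G" "Q 0"
    and "\<And>x y. x \<in> carrier G \<Longrightarrow> y \<in> carrier G \<Longrightarrow> Q x \<Longrightarrow> Q y \<Longrightarrow> Q (x - y)"
    and "\<And>a b. a \<in> carrier A \<Longrightarrow> b \<in> carrier T \<Longrightarrow> Q (frag_of (a, b))"
  shows "Q f"
  by (rule free_Abelian_group_induct[of f "carrier A \<times> carrier T"]) (use assms in auto)

lemma subgroup_H: "subgroup H G"
  by (rule G.generate_is_subgroup[OF relations_subset])

lemma H_subset: "H \<subseteq> carrier G"
  by (rule subgroup.subset[OF subgroup_H])

lemma normal_H: "H \<lhd> G"
  by (rule G.normal_iff_subgroup[THEN iffD2, OF subgroup_H])

lemma H_incl: "f \<in> Rel \<Longrightarrow> f \<in> H"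
  by (rule generate.incl)

lemma carrier_base_change: "carrier B = cls ` carrier G"
  by (auto simp: base_change_def Let_def FactGroup_def RCOSETS_def)

lemma zero_base_change: "\<zero>\<^bsub>B\<^esub> = H"
  by (simp add: base_change_def Let_def FactGroup_def)

lemma add_base_change:
  "f \<in> carrier G \<Longrightarrow> g \<in> carrier G \<Longrightarrow> cls f \<oplus>\<^bsub>B\<^esub> cls g = cls (f + g)"
  using normal.rcos_sum[OF normal_H, of f g]
  by (simp add: base_change_def Let_def FactGroup_def)

lemma cls_eq_zero_iff: "f \<in> carrier G \<Longrightarrow> cls f = \<zero>\<^bsub>B\<^esub> \<longleftrightarrow> f \<in> H"
  unfolding zero_base_change
  by (metis G.coset_join1 G.coset_join2 G.coset_mult_inv1 subgroup_H H_subset)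

abbreviation act :: "'t \<Rightarrow> ('b \<times> 't \<Rightarrow>\<^sub>0 int) \<Rightarrow> ('b \<times> 't \<Rightarrow>\<^sub>0 int)"
  where "act t \<equiv> frag_extend (\<lambda>(a, b). frag_of (a, b \<otimes>\<^bsub>T\<^esub> t))"

lemma act_closed:
  assumes t: "t \<in> carrier T" and "f \<in> carrier G"
  shows "act t f \<in> carrier G"
  using assms(2)
proof (induction f rule: free_induct)
  case (diff x y)
  then show ?case by (simp only: frag_extend_diff diff_closed)
qed (use t in auto)

text \<open>Right multiplication by \<open>t\<close> on the second factor turns each relation into a
  relation of the same kind, by right distributivity and associativity of \<open>T\<close>; the
  elements sent into \<open>H\<close> form a subgroup, which thus contains \<open>H\<close>.\<close>

lemma act_H:
  assumes t: "t \<in> carrier T" and "f \<in> H"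
  shows "act t f \<in> H"
proof -
  have sub: "subgroup {f \<in> carrier G. act t f \<in> H} G"
  proof (rule G.subgroupI)
    fix f g assume "f \<in> {f \<in> carrier G. act t f \<in> H}" "g \<in> {f \<in> carrier G. act t f \<in> H}"
    then show "f \<otimes>\<^bsub>G\<^esub> g \<in> {f \<in> carrier G. act t f \<in> H}"
      using subgroup.m_closed[OF subgroup_H] G.m_closed[of f g] by (auto simp: frag_extend_add)
  next
    fix f assume f: "f \<in> {f \<in> carrier G. act t f \<in> H}"
    then have "inv\<^bsub>G\<^esub> (act t f) \<in> H" "inv\<^bsub>G\<^esub> f \<in> carrier G"
      using subgroup.m_inv_closed[OF subgroup_H] by blast+
    moreover have "act t f \<in> carrier G" using f act_closed[OF t] by blast
    ultimately show "inv\<^bsub>G\<^esub> f \<in> {f \<in> carrier G. act t f \<in> H}"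
      using f by (simp add: frag_extend_minus)
  next
    have "0 \<in> {f \<in> carrier G. act t f \<in> H}" using subgroup.one_closed[OF subgroup_H] by simp
    then show "{f \<in> carrier G. act t f \<in> H} \<noteq> {}" by blast
  qed auto
  have "act t f \<in> Rel" if "f \<in> Rel" for f
    using that
  proof (cases rule: relation_cases)
    case (add_left a a' b)
    then show ?thesis using relation_add_left[of a a' "b \<otimes>\<^bsub>T\<^esub> t"] t by (simp add: frag_extend_diff)
  next
    case (add_right a b b')
    then show ?thesis
      using relation_add_right[of a "b \<otimes>\<^bsub>T\<^esub> t" "b' \<otimes>\<^bsub>T\<^esub> t"] t
      by (simp add: frag_extend_diff T.l_distr)
  next
    case (balanced a s b)
    then show ?thesis
      using relation_balanced[of a s "b \<otimes>\<^bsub>T\<^esub> t"] t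
      by (simp add: frag_extend_diff T.m_assoc \<iota>_closed)
  qed
  then have "Rel \<subseteq> {f \<in> carrier G. act t f \<in> H}"
    using relations_subset H_incl by blast
  then have "H \<subseteq> {f \<in> carrier G. act t f \<in> H}"
    by (rule G.generate_subgroup_incl[OF _ sub])
  then show ?thesis using assms(2) by blast
qed

text \<open>The definition of the action unites the cosets obtained from all representatives. They
  coincide because \<open>act t\<close> is additive and preserves \<open>H\<close>.\<close>

lemma ract_base_change:
  assumes t: "t \<in> carrier T" and f: "f \<in> carrier G"
  shows "cls f \<lhd>\<^bsub>B\<^esub> t = cls (act t f)"
proof -
  have cong: "cls (act t g) = cls (act t f)" if g: "g \<in> cls f" for g
  proof -
    obtain h where h: "h \<in> H" "g = h + f" using g by (auto simp: r_coset_def)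
    have "cls (act t h + act t f) = cls (act t h) #>\<^bsub>G\<^esub> act t f"
      using G.coset_mult_assoc[OF H_subset, of "act t h" "act t f"] act_closed[OF t] h H_subset f
      by auto
    also have "cls (act t h) = H"
      using G.coset_join2[OF _ subgroup_H] act_H[OF t h(1)] H_subset by blast
    finally show ?thesis by (simp add: h(2) frag_extend_add)
  qed
  \<comment> \<open>The union of a constant family is that constant only over a nonempty index
    set.\<close>
  have ne: "cls f \<noteq> {}" using G.rcos_self[OF f subgroup_H] by blast
  have "cls f \<lhd>\<^bsub>B\<^esub> t = (\<Union>g\<in>cls f. cls (act t g))"
    by (simp only: base_change_def Let_def rmod.simps)
  also have "\<dots> = (\<Union>g\<in>cls f. cls (act t f))"
    by (rule SUP_cong[OF refl cong])
  also have "\<dots> = cls (act t f)" using ne by (simp only: UN_constant if_False)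
  finally show ?thesis .
qed

end

section \<open>A copy of the tensor product in a given type\<close>

locale base_change_copy = base_change_setup S T \<iota> A + P: right_module T P
  for S :: "('s, 'k) ring_scheme" and T :: "('t, 'l) ring_scheme" (structure)
    and \<iota> :: "'s \<Rightarrow> 't" and A :: "('s, 'b) rmod" and P :: "('t, 'c) rmod" +
  fixes h
  assumes h_hom: "h \<in> rmod_hom T P B" and h_bij: "bij_betw h (carrier P) (carrier B)"
begin

text \<open>Pulling classes back along \<open>h\<close> replaces computations with cosets by
  computations in the module \<open>P\<close>.\<close>

definition c where "c f = inv_into (carrier P) h (cls f)"

definition tensor :: "'b \<Rightarrow> 't \<Rightarrow> 'c" where "tensor a b = c (frag_of (a, b))"

lemma h_c: "f \<in> carrier G \<Longrightarrow> h (c f) = cls f"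
  unfolding c_def by (rule bij_betw_inv_into_right[OF h_bij]) (simp only: carrier_base_change imageI)

lemma c_closed: "f \<in> carrier G \<Longrightarrow> c f \<in> carrier P"
  unfolding c_def using bij_betwE[OF bij_betw_inv_into[OF h_bij]] carrier_base_change by blast

lemma h_eqD: "x \<in> carrier P \<Longrightarrow> y \<in> carrier P \<Longrightarrow> h x = h y \<Longrightarrow> x = y"
  using h_bij by (auto simp: bij_betw_def dest: inj_onD)

lemma c_add: "f \<in> carrier G \<Longrightarrow> g \<in> carrier G \<Longrightarrow> c (f + g) = c f \<oplus>\<^bsub>P\<^esub> c g"
  using G.m_closed[of f g]
  by (intro h_eqD) (simp_all add: c_closed h_c rmod_hom_add[OF h_hom] add_base_change
      del: carrier_free_Abelian_group_iff)

lemma c_surj: "y \<in> carrier P \<Longrightarrow> \<exists>f \<in> carrier G. y = c f"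
proof -
  assume y: "y \<in> carrier P"
  then have "h y \<in> cls ` carrier G"
    using rmod_hom_closed[OF h_hom y] carrier_base_change by simp
  then obtain f where f: "f \<in> carrier G" "h y = cls f" by blast
  then have "y = c f" using y by (intro h_eqD c_closed) (simp_all only: h_c)
  then show ?thesis using f by blast
qed

lemma c_zero: "c 0 = \<zero>\<^bsub>P\<^esub>"
  using c_add[of 0 0] c_closed[of 0] by (metis P.M.add.r_cancel_one add.right_neutral G.one_closed one_free_Abelian_group)

lemma c_minus: "f \<in> carrier G \<Longrightarrow> g \<in> carrier G \<Longrightarrow> c (f - g) = c f \<ominus>\<^bsub>P\<^esub> c g"
proof -
  assume fg: "f \<in> carrier G" "g \<in> carrier G"
  then have d: "f - g \<in> carrier G" by (rule diff_closed)
  have "c f = c (f - g) \<oplus>\<^bsub>P\<^esub> c g" using c_add[OF d fg(2)] by simp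
  then show ?thesis
    using c_closed[OF d] c_closed[OF fg(2)] by (simp add: a_minus_def P.M.a_assoc P.M.r_neg)
qed

text \<open>From right to left this yields the tensor identities; from left to right it turns the
  vanishing of a tensor into membership in \<open>H\<close>, on which the kernel computation
  rests.\<close>

lemma c_eq_zero_iff:
  assumes "f \<in> carrier G"
  shows "c f = \<zero>\<^bsub>P\<^esub> \<longleftrightarrow> f \<in> H"
proof -
  have "0 \<in> H" using subgroup.one_closed[OF subgroup_H] by simp
  then have "cls 0 = \<zero>\<^bsub>B\<^esub>" using cls_eq_zero_iff[of 0] by simp
  then have "h \<zero>\<^bsub>P\<^esub> = \<zero>\<^bsub>B\<^esub>" using h_c[of 0] c_zero by simp
  then have "c f = \<zero>\<^bsub>P\<^esub> \<longleftrightarrow> cls f = \<zero>\<^bsub>B\<^esub>"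
    using h_eqD[OF c_closed[OF assms] P.M.zero_closed] h_c[OF assms] by auto
  then show ?thesis using cls_eq_zero_iff[OF assms] by simp
qed

lemma tensor_closed: "a \<in> carrier A \<Longrightarrow> b \<in> carrier T \<Longrightarrow> tensor a b \<in> carrier P"
  unfolding tensor_def by (rule c_closed) simp

lemma tensor_ract:
  assumes "a \<in> carrier A" "b \<in> carrier T" "t \<in> carrier T"
  shows "tensor a b \<lhd>\<^bsub>P\<^esub> t = tensor a (b \<otimes>\<^bsub>T\<^esub> t)"
  unfolding tensor_def
proof (rule h_eqD)
  have f: "frag_of (a, b) \<in> carrier G" "frag_of (a, b \<otimes>\<^bsub>T\<^esub> t) \<in> carrier G" using assms by auto
  then show "c (frag_of (a, b)) \<lhd>\<^bsub>P\<^esub> t \<in> carrier P" "c (frag_of (a, b \<otimes>\<^bsub>T\<^esub> t)) \<in> carrier P"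
    by (simp_all only: P.ract_closed c_closed assms(3))
  show "h (c (frag_of (a, b)) \<lhd>\<^bsub>P\<^esub> t) = h (c (frag_of (a, b \<otimes>\<^bsub>T\<^esub> t)))"
    unfolding rmod_hom_ract[OF h_hom c_closed[OF f(1)] assms(3)] h_c[OF f(1)] h_c[OF f(2)]
      ract_base_change[OF assms(3) f(1)] by simp
qed

lemma tensor_add_left:
  assumes "a \<in> carrier A" "a' \<in> carrier A" "b \<in> carrier T"
  shows "tensor (a \<oplus>\<^bsub>A\<^esub> a') b = tensor a b \<oplus>\<^bsub>P\<^esub> tensor a' b"
proof -
  let ?x = "frag_of (a \<oplus>\<^bsub>A\<^esub> a', b)" and ?y = "frag_of (a, b)" and ?z = "frag_of (a', b)"
  have cl: "?x \<in> carrier G" "?y \<in> carrier G" "?z \<in> carrier G"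
    using assms by (simp_all only: frag_of_closed A_add_closed)
  have "c (?x - ?y - ?z) = \<zero>\<^bsub>P\<^esub>"
    using c_eq_zero_iff relations_subset H_incl relation_add_left[OF assms] by blast
  \<comment> \<open>Writing \<open>?x\<close> as a sum lets \<open>c_add\<close> apply; the first
    summand vanishes in \<open>P\<close>.\<close>
  moreover have "?x = (?x - ?y - ?z) + (?y + ?z)" by simp
  moreover have "?x - ?y - ?z \<in> carrier G" "?y + ?z \<in> carrier G"
    using cl by (simp_all only: diff_closed add_closed)
  ultimately have "c ?x = \<zero>\<^bsub>P\<^esub> \<oplus>\<^bsub>P\<^esub> (c ?y \<oplus>\<^bsub>P\<^esub> c ?z)" using c_add cl by metis
  then show ?thesis using c_closed cl by (simp add: tensor_def del: carrier_free_Abelian_group_iff)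
qed

lemma tensor_balanced:
  assumes "a \<in> carrier A" "s \<in> carrier S" "b \<in> carrier T"
  shows "tensor (a \<lhd>\<^bsub>A\<^esub> s) b = tensor a (\<iota> s \<otimes>\<^bsub>T\<^esub> b)"
proof -
  let ?x = "frag_of (a \<lhd>\<^bsub>A\<^esub> s, b)" and ?y = "frag_of (a, \<iota> s \<otimes>\<^bsub>T\<^esub> b)"
  have cl: "?x \<in> carrier G" "?y \<in> carrier G"
    using assms by (simp_all only: frag_of_closed A_ract_closed T.m_closed \<iota>_closed)
  have "c (?x - ?y) = \<zero>\<^bsub>P\<^esub>"
    using c_eq_zero_iff relations_subset H_incl relation_balanced[OF assms] by blast
  moreover have "?x = (?x - ?y) + ?y" by simp
  moreover have "?x - ?y \<in> carrier G" using cl by (rule diff_closed)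
  ultimately have "c ?x = \<zero>\<^bsub>P\<^esub> \<oplus>\<^bsub>P\<^esub> c ?y" using c_add cl by metis
  then show ?thesis using c_closed cl by (simp add: tensor_def del: carrier_free_Abelian_group_iff)
qed

text \<open>Pure tensors generate \<open>P\<close> as a group, and closure under differences passes
  from generators to the whole group.\<close>

lemma tensor_induct [consumes 1, case_names zero minus tensor]:
  assumes y: "y \<in> carrier P"
    and zero: "Q \<zero>\<^bsub>P\<^esub>"
    and minus: "\<And>y z. y \<in> carrier P \<Longrightarrow> z \<in> carrier P \<Longrightarrow> Q y \<Longrightarrow> Q z \<Longrightarrow> Q (y \<ominus>\<^bsub>P\<^esub> z)"
    and tensor: "\<And>a b. a \<in> carrier A \<Longrightarrow> b \<in> carrier T \<Longrightarrow> Q (tensor a b)"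
  shows "Q y"
proof -
  obtain f where f: "f \<in> carrier G" "y = c f" using c_surj[OF y] by blast
  from f(1) have "Q (c f)"
  proof (induction f rule: free_induct)
    case zero
    show ?case using assms(2) c_zero by simp
  next
    case (diff x y)
    then show ?case by (simp only: c_minus c_closed minus)
  next
    case (frag_of a b)
    then show ?case using tensor by (simp add: tensor_def)
  qed
  then show ?thesis using f by simp
qed

end


section \<open>Laurent polynomials\<close>

text \<open>Constants, \<open>1\<close>, \<open>X\<close> and its inverse are all of this form, so
  that one product rule covers them.\<close>

definition laurent_monom :: "('a, 'k) ring_scheme \<Rightarrow> 'a \<Rightarrow> int \<Rightarrow> int \<Rightarrow> 'a"
  where "laurent_monom R r k = (\<lambda>i. if i = k then r else \<zero>\<^bsub>R\<^esub>)"

lemma laurent_const_eq_monom: "laurent_const R r = laurent_monom R r 0"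
  and laurent_X_eq_monom: "laurent_X R = laurent_monom R \<one>\<^bsub>R\<^esub> 1"
  and laurent_one_eq_monom: "\<one>\<^bsub>laurent R\<^esub> = laurent_monom R \<one>\<^bsub>R\<^esub> 0"
  by (simp_all add: laurent_const_def laurent_X_def laurent_monom_def laurent_def)

lemma carrier_laurent: "carrier (laurent R) = laurent_carrier R"
  and laurent_add: "p \<oplus>\<^bsub>laurent R\<^esub> q = (\<lambda>k. p k \<oplus>\<^bsub>R\<^esub> q k)"
  by (simp_all add: laurent_def)

lemma laurent_carrierD: "p \<in> laurent_carrier R \<Longrightarrow> p i \<in> carrier R"
  and laurent_carrier_finite: "p \<in> laurent_carrier R \<Longrightarrow> finite {i. p i \<noteq> \<zero>\<^bsub>R\<^esub>}"
  by (auto simp: laurent_carrier_def)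

lemma laurent_carrier_bound:
  assumes "p \<in> laurent_carrier R"
  obtains d :: nat where "\<And>i. \<bar>i\<bar> > int d \<Longrightarrow> p i = \<zero>\<^bsub>R\<^esub>"
proof -
  obtain d where "(\<lambda>i. nat \<bar>i\<bar>) ` {i. p i \<noteq> \<zero>\<^bsub>R\<^esub>} \<subseteq> {..d}"
    using finite_nat_iff_bounded_le[of "(\<lambda>i. nat \<bar>i\<bar>) ` {i. p i \<noteq> \<zero>\<^bsub>R\<^esub>}"] laurent_carrier_finite[OF assms]
    by auto
  then have "p i = \<zero>\<^bsub>R\<^esub>" if "\<bar>i\<bar> > int d" for i using that by fastforce
  then show thesis by (rule that)
qed

context ring
begin

lemma laurent_monom_closed: "r \<in> carrier R \<Longrightarrow> laurent_monom R r k \<in> laurent_carrier R"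
  by (auto simp: laurent_carrier_def laurent_monom_def
      intro: finite_subset[of _ "{k}"] split: if_splits)

text \<open>The product sums over the support of the left factor; enlarging it to any convenient
  finite set only adds zero terms.\<close>

lemma laurent_mult_eq_finsum:
  assumes "p \<in> laurent_carrier R" "q \<in> laurent_carrier R" "finite I" "{i. p i \<noteq> \<zero>} \<subseteq> I"
  shows "(p \<otimes>\<^bsub>laurent R\<^esub> q) k = (\<Oplus>i\<in>I. p i \<otimes> q (k - i))"
  unfolding laurent_def
  using assms laurent_carrierD[OF assms(1)] laurent_carrierD[OF assms(2)]
  by (auto intro!: add.finprod_mono_neutral_cong_left)

lemma laurent_monom_mult:
  assumes r: "r \<in> carrier R" and q: "q \<in> laurent_carrier R"
  shows "laurent_monom R r k \<otimes>\<^bsub>laurent R\<^esub> q = (\<lambda>i. r \<otimes> q (i - k))"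
proof
  fix i
  show "(laurent_monom R r k \<otimes>\<^bsub>laurent R\<^esub> q) i = r \<otimes> q (i - k)"
    by (subst laurent_mult_eq_finsum[OF laurent_monom_closed[OF r] q, of "{k}"])
      (auto simp: laurent_monom_def r laurent_carrierD[OF q])
qed

lemma laurent_mult_monom:
  assumes p: "p \<in> laurent_carrier R" and s: "s \<in> carrier R"
  shows "p \<otimes>\<^bsub>laurent R\<^esub> laurent_monom R s l = (\<lambda>i. p (i - l) \<otimes> s)"
proof
  fix i
  \<comment> \<open>The index \<open>i - l\<close> is added to the support of \<open>p\<close> so
    that it is present also where \<open>p\<close> vanishes; all other terms are zero.\<close>
  let ?I = "insert (i - l) {i. p i \<noteq> \<zero>}"
  have "(p \<otimes>\<^bsub>laurent R\<^esub> laurent_monom R s l) i = (\<Oplus>j\<in>?I. p j \<otimes> laurent_monom R s l (i - j))"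
    by (rule laurent_mult_eq_finsum)
      (auto simp: p s laurent_monom_closed laurent_carrier_finite)
  also have "\<dots> = (\<Oplus>j\<in>?I. if i - l = j then p j \<otimes> s else \<zero>)"
    by (rule finsum_cong') (auto simp: laurent_monom_def laurent_carrierD[OF p] s)
  also have "\<dots> = p (i - l) \<otimes> s"
    by (rule finsum_singleton) (auto simp: laurent_carrier_finite[OF p] laurent_carrierD[OF p] s)
  finally show "(p \<otimes>\<^bsub>laurent R\<^esub> laurent_monom R s l) i = p (i - l) \<otimes> s" .
qed

lemma laurent_monom_mult_monom:
  assumes "r \<in> carrier R" "s \<in> carrier R"
  shows "laurent_monom R r k \<otimes>\<^bsub>laurent R\<^esub> laurent_monom R s l = laurent_monom R (r \<otimes> s) (k + l)"
  unfolding laurent_monom_mult[OF assms(1) laurent_monom_closed[OF assms(2)]]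
  using assms by (auto simp: laurent_monom_def)

section \<open>Polynomials and their passage to Laurent polynomials\<close>

lemma carrier_UP: "carrier (UP R) = up R"
  by (simp add: UP_def)

lemma coeff_UP: "p \<in> up R \<Longrightarrow> up_ring.coeff (UP R) p i = p i"
  by (simp add: UP_def)

lemma up_closed: "p \<in> up R \<Longrightarrow> p i \<in> carrier R"
  by (auto simp: up_def)

lemma up_bound:
  assumes "p \<in> up R"
  obtains d where "\<And>i. i > d \<Longrightarrow> p i = \<zero>"
  using assms unfolding up_def by (auto dest: bound.bound)

lemma deg_UP_aboveD: "p \<in> up R \<Longrightarrow> deg R p < i \<Longrightarrow> p i = \<zero>"
  using UP_ring.deg_aboveD[of R p i] by (simp add: UP_ring_def ring_axioms carrier_UP coeff_UP)

lemma laurent_of_poly_apply: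
  "p \<in> up R \<Longrightarrow> laurent_of_poly R p i = (if i < 0 then \<zero> else p (nat i))"
  by (simp add: laurent_of_poly_def coeff_UP)

lemma laurent_of_poly_closed:
  assumes p: "p \<in> up R"
  shows "laurent_of_poly R p \<in> laurent_carrier R"
proof -
  obtain d where "\<And>i. i > d \<Longrightarrow> p i = \<zero>" using up_bound[OF p] by metis
  then have "{i. laurent_of_poly R p i \<noteq> \<zero>} \<subseteq> int ` {..d}"
    by (auto simp: laurent_of_poly_apply[OF p] image_iff split: if_splits)
      (metis atMost_iff int_nat_eq linorder_not_less)
  then show ?thesis
    using up_closed[OF p] by (auto simp: laurent_carrier_def laurent_of_poly_apply[OF p] finite_subset)
qed

definition up_monom :: "'a \<Rightarrow> nat \<Rightarrow> nat \<Rightarrow> 'a" where "up_monom r n = (\<lambda>i. if i = n then r else \<zero>)"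

lemma up_monom_closed: "r \<in> carrier R \<Longrightarrow> up_monom r n \<in> up R"
  by (auto simp: up_def up_monom_def intro!: exI[of _ n] bound.intro)

lemma laurent_of_up_monom:
  assumes "r \<in> carrier R"
  shows "laurent_of_poly R (up_monom r n) = laurent_monom R r (int n)"
  unfolding fun_eq_iff laurent_of_poly_apply[OF up_monom_closed[OF assms]]
  by (auto simp: up_monom_def laurent_monom_def)

end

section \<open>Finite sums in a right module\<close>

context right_module
begin

lemma finsum_swap:
  assumes "finite I" "finite J" "\<And>i j. i \<in> I \<Longrightarrow> j \<in> J \<Longrightarrow> F i j \<in> carrier M"
  shows "(\<Oplus>\<^bsub>M\<^esub>i\<in>I. \<Oplus>\<^bsub>M\<^esub>j\<in>J. F i j) = (\<Oplus>\<^bsub>M\<^esub>j\<in>J. \<Oplus>\<^bsub>M\<^esub>i\<in>I. F i j)"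
  using assms(1,3)
proof (induction I rule: finite_induct)
  case empty
  then show ?case by simp
next
  case (insert i I)
  have cl: "(\<lambda>j. F i j) \<in> J \<rightarrow> carrier M" "(\<lambda>j. \<Oplus>\<^bsub>M\<^esub>i\<in>I. F i j) \<in> J \<rightarrow> carrier M"
    "(\<lambda>i. \<Oplus>\<^bsub>M\<^esub>j\<in>J. F i j) \<in> I \<rightarrow> carrier M"
    using insert.prems by (auto intro!: M.finsum_closed)
  have "(\<Oplus>\<^bsub>M\<^esub>k\<in>insert i I. \<Oplus>\<^bsub>M\<^esub>j\<in>J. F k j)
      = (\<Oplus>\<^bsub>M\<^esub>j\<in>J. F i j) \<oplus>\<^bsub>M\<^esub> (\<Oplus>\<^bsub>M\<^esub>k\<in>I. \<Oplus>\<^bsub>M\<^esub>j\<in>J. F k j)"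
    using insert.hyps cl by (intro M.finsum_insert M.finsum_closed) auto
  also have "\<dots> = (\<Oplus>\<^bsub>M\<^esub>j\<in>J. F i j) \<oplus>\<^bsub>M\<^esub> (\<Oplus>\<^bsub>M\<^esub>j\<in>J. \<Oplus>\<^bsub>M\<^esub>k\<in>I. F k j)"
    using insert.IH insert.prems by simp
  also have "\<dots> = (\<Oplus>\<^bsub>M\<^esub>j\<in>J. F i j \<oplus>\<^bsub>M\<^esub> (\<Oplus>\<^bsub>M\<^esub>k\<in>I. F k j))"
    using cl by (simp add: M.finsum_addf)
  also have "\<dots> = (\<Oplus>\<^bsub>M\<^esub>j\<in>J. \<Oplus>\<^bsub>M\<^esub>k\<in>insert i I. F k j)"
    using insert by (intro M.finsum_cong') (auto intro!: M.finsum_closed M.finsum_insert[symmetric])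
  finally show ?case .
qed

lemma finsum_additive:
  assumes g: "\<And>x. x \<in> carrier M \<Longrightarrow> g x \<in> carrier M"
    "\<And>x y. x \<in> carrier M \<Longrightarrow> y \<in> carrier M \<Longrightarrow> g (x \<oplus>\<^bsub>M\<^esub> y) = g x \<oplus>\<^bsub>M\<^esub> g y"
    and "finite I" "\<And>i. i \<in> I \<Longrightarrow> u i \<in> carrier M"
  shows "g (\<Oplus>\<^bsub>M\<^esub>i\<in>I. u i) = (\<Oplus>\<^bsub>M\<^esub>i\<in>I. g (u i))"
  using assms(3,4)
proof (induction I rule: finite_induct)
  case empty
  have "g \<zero>\<^bsub>M\<^esub> = \<zero>\<^bsub>M\<^esub>"
    using g(1)[OF M.zero_closed] g(2)[OF M.zero_closed M.zero_closed] by simp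
  then show ?case by simp
next
  case (insert i I)
  then have "g (\<Oplus>\<^bsub>M\<^esub>k\<in>insert i I. u k) = g (u i \<oplus>\<^bsub>M\<^esub> (\<Oplus>\<^bsub>M\<^esub>k\<in>I. u k))"
    by (subst M.finsum_insert) auto
  also have "\<dots> = g (u i) \<oplus>\<^bsub>M\<^esub> (\<Oplus>\<^bsub>M\<^esub>k\<in>I. g (u k))"
    using insert by (simp add: g M.finsum_closed)
  also have "\<dots> = (\<Oplus>\<^bsub>M\<^esub>k\<in>insert i I. g (u k))"
    using insert g(1) by (intro M.finsum_insert[symmetric]) auto
  finally show ?case .
qed

lemma ract_finsum_right:
  assumes "x \<in> carrier M" "finite I" "\<And>i. i \<in> I \<Longrightarrow> r i \<in> carrier R"
  shows "x \<lhd>\<^bsub>M\<^esub> (\<Oplus>\<^bsub>R\<^esub>i\<in>I. r i) = (\<Oplus>\<^bsub>M\<^esub>i\<in>I. x \<lhd>\<^bsub>M\<^esub> r i)"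
  using assms(2,3)
proof (induction I rule: finite_induct)
  case empty
  then show ?case using assms(1) by (simp add: ract_zero_right)
next
  case (insert i I)
  then have "x \<lhd>\<^bsub>M\<^esub> (\<Oplus>\<^bsub>R\<^esub>k\<in>insert i I. r k) = x \<lhd>\<^bsub>M\<^esub> (r i \<oplus>\<^bsub>R\<^esub> (\<Oplus>\<^bsub>R\<^esub>k\<in>I. r k))"
    by (subst R.finsum_insert) auto
  also have "\<dots> = x \<lhd>\<^bsub>M\<^esub> r i \<oplus>\<^bsub>M\<^esub> (\<Oplus>\<^bsub>M\<^esub>k\<in>I. x \<lhd>\<^bsub>M\<^esub> r k)"
    using insert assms(1) by (simp add: ract_add_right R.finsum_closed)
  also have "\<dots> = (\<Oplus>\<^bsub>M\<^esub>k\<in>insert i I. x \<lhd>\<^bsub>M\<^esub> r k)"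
    using insert assms(1) by (intro M.finsum_insert[symmetric]) (auto intro: ract_closed)
  finally show ?case .
qed

end


section \<open>The extension of a module to Laurent polynomials\<close>

lemma carrier_poly_module: "carrier (poly_module R M \<phi>) = carrier M"
  and poly_module_add: "x \<oplus>\<^bsub>poly_module R M \<phi>\<^esub> y = x \<oplus>\<^bsub>M\<^esub> y"
  by (simp_all add: poly_module_def)

context right_module_endo
begin

lemmas pow_closed = rmod_hom_closed[OF funpow_hom]

text \<open>The definition sums up to the degree; any bound on the support may stand in for it,
  since the terms in between are zero.\<close>

lemma poly_ract_eq:
  assumes x: "x \<in> carrier M" and p: "p \<in> up R" and "\<And>i. i > d \<Longrightarrow> p i = \<zero>\<^bsub>R\<^esub>"
  shows "x \<lhd>\<^bsub>poly_module R M \<phi>\<^esub> p = (\<Oplus>\<^bsub>M\<^esub>i\<in>{..d}. (\<phi> ^^ i) x \<lhd>\<^bsub>M\<^esub> p i)"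
proof -
  have "x \<lhd>\<^bsub>poly_module R M \<phi>\<^esub> p = (\<Oplus>\<^bsub>M\<^esub>i\<in>{..deg R p}. (\<phi> ^^ i) x \<lhd>\<^bsub>M\<^esub> p i)"
    by (simp add: poly_module_def R.coeff_UP[OF p])
  also have "\<dots> = (\<Oplus>\<^bsub>M\<^esub>i\<in>{..d}. (\<phi> ^^ i) x \<lhd>\<^bsub>M\<^esub> p i)"
    using assms(3) R.deg_UP_aboveD[OF p]
    by (intro M.add.finprod_mono_neutral_cong)
      (auto simp: pow_closed[OF x] ract_zero_right R.up_closed[OF p] ract_closed)
  finally show ?thesis .
qed

lemma poly_ract_closed:
  assumes x: "x \<in> carrier M" and p: "p \<in> up R"
  shows "x \<lhd>\<^bsub>poly_module R M \<phi>\<^esub> p \<in> carrier M"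
proof -
  obtain d where d: "\<And>i. i > d \<Longrightarrow> p i = \<zero>\<^bsub>R\<^esub>" using R.up_bound[OF p] by metis
  show ?thesis
    by (subst poly_ract_eq[OF x p d], assumption, intro M.finsum_closed)
      (auto intro: ract_closed pow_closed x R.up_closed[OF p])
qed

text \<open>With \<open>n = 0\<close> this recovers the scalars of \<open>R\<close>, and with
  \<open>n = 1\<close> and coefficient 1 the action of \<open>\<phi>\<close>; both are used to see
  that \<open>x \<mapsto> x \<otimes> 1\<close> respects the two structures.\<close>

lemma poly_ract_monom:
  assumes x: "x \<in> carrier M" and r: "r \<in> carrier R"
  shows "x \<lhd>\<^bsub>poly_module R M \<phi>\<^esub> R.up_monom r n = (\<phi> ^^ n) x \<lhd>\<^bsub>M\<^esub> r"
proof -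
  have "x \<lhd>\<^bsub>poly_module R M \<phi>\<^esub> R.up_monom r n
      = (\<Oplus>\<^bsub>M\<^esub>i\<in>{..n}. (\<phi> ^^ i) x \<lhd>\<^bsub>M\<^esub> R.up_monom r n i)"
    by (rule poly_ract_eq[OF x R.up_monom_closed[OF r]]) (simp add: R.up_monom_def)
  also have "\<dots> = (\<Oplus>\<^bsub>M\<^esub>i\<in>{..n}. if n = i then (\<phi> ^^ i) x \<lhd>\<^bsub>M\<^esub> r else \<zero>\<^bsub>M\<^esub>)"
    by (rule M.finsum_cong') (auto simp: R.up_monom_def ract_zero_right pow_closed[OF x] ract_closed r)
  also have "\<dots> = (\<phi> ^^ n) x \<lhd>\<^bsub>M\<^esub> r"
    by (rule M.finsum_singleton) (auto simp: pow_closed[OF x] ract_closed r)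
  finally show ?thesis .
qed

text \<open>The truncation of \<open>x \<otimes> b X\<^sup>k\<close> to its polynomial part, evaluated in \<open>M\<close>. It respects the
  balancing relation only once \<open>k\<close> is so large that nothing is cut off.\<close>

definition shifted_eval :: "nat \<Rightarrow> 'b \<Rightarrow> (int \<Rightarrow> 'a) \<Rightarrow> 'b" where
  "shifted_eval k x b =
    (\<Oplus>\<^bsub>M\<^esub>j\<in>{j. b (int j - int k) \<noteq> \<zero>\<^bsub>R\<^esub>}. (\<phi> ^^ j) x \<lhd>\<^bsub>M\<^esub> b (int j - int k))"

lemma shifted_eval_eq:
  assumes x: "x \<in> carrier M" and b: "b \<in> laurent_carrier R"
    and d: "\<And>j. j \<ge> d \<Longrightarrow> b (int j - int k) = \<zero>\<^bsub>R\<^esub>"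
  shows "shifted_eval k x b = (\<Oplus>\<^bsub>M\<^esub>j\<in>{..<d}. (\<phi> ^^ j) x \<lhd>\<^bsub>M\<^esub> b (int j - int k))"
  unfolding shifted_eval_def
proof (rule M.add.finprod_mono_neutral_cong_left)
  show "{j. b (int j - int k) \<noteq> \<zero>\<^bsub>R\<^esub>} \<subseteq> {..<d}" using d not_le by blast
qed (auto simp: ract_zero_right pow_closed[OF x] ract_closed laurent_carrierD[OF b])

lemma laurent_carrier_shift_bound:
  assumes "b \<in> laurent_carrier R"
  obtains d where "\<And>j. j \<ge> d \<Longrightarrow> b (int j - int k) = \<zero>\<^bsub>R\<^esub>"
proof -
  obtain d where d: "\<And>i. \<bar>i\<bar> > int d \<Longrightarrow> b i = \<zero>\<^bsub>R\<^esub>" using laurent_carrier_bound[OF assms] by metis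
  show thesis by (rule that[of "d + k + 1"]) (rule d, linarith)
qed

lemma shifted_eval_closed:
  assumes "x \<in> carrier M" "b \<in> laurent_carrier R"
  shows "shifted_eval k x b \<in> carrier M"
  unfolding shifted_eval_def
  using assms by (intro M.finsum_closed) (auto intro: ract_closed pow_closed laurent_carrierD)

text \<open>This is how a vanishing tensor \<open>x \<otimes> 1\<close> produces a power of
  \<open>\<phi>\<close> that kills \<open>x\<close>.\<close>

lemma shifted_eval_one:
  assumes x: "x \<in> carrier M"
  shows "shifted_eval k x \<one>\<^bsub>laurent R\<^esub> = (\<phi> ^^ k) x"
proof -
  have "shifted_eval k x \<one>\<^bsub>laurent R\<^esub>
      = (\<Oplus>\<^bsub>M\<^esub>j\<in>{..<Suc k}. (\<phi> ^^ j) x \<lhd>\<^bsub>M\<^esub> \<one>\<^bsub>laurent R\<^esub> (int j - int k))"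
    by (rule shifted_eval_eq[OF x])
      (auto simp: laurent_one_eq_monom R.laurent_monom_closed, simp add: laurent_monom_def)
  also have "\<dots> = (\<Oplus>\<^bsub>M\<^esub>j\<in>{..<Suc k}. if k = j then (\<phi> ^^ j) x else \<zero>\<^bsub>M\<^esub>)"
    by (rule M.finsum_cong')
      (auto simp: laurent_one_eq_monom laurent_monom_def ract_zero_right ract_one pow_closed[OF x])
  also have "\<dots> = (\<phi> ^^ k) x"
    by (rule M.finsum_singleton) (auto simp: pow_closed[OF x])
  finally show ?thesis .
qed

lemma shifted_eval_add_left:
  assumes x: "x \<in> carrier M" and y: "y \<in> carrier M" and b: "b \<in> laurent_carrier R"
  shows "shifted_eval k (x \<oplus>\<^bsub>M\<^esub> y) b = shifted_eval k x b \<oplus>\<^bsub>M\<^esub> shifted_eval k y b"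
proof -
  obtain d where d: "\<And>j. j \<ge> d \<Longrightarrow> b (int j - int k) = \<zero>\<^bsub>R\<^esub>"
    using laurent_carrier_shift_bound[OF b, of k] by metis
  note cl = pow_closed[OF x] pow_closed[OF y] laurent_carrierD[OF b]
  have "shifted_eval k (x \<oplus>\<^bsub>M\<^esub> y) b = (\<Oplus>\<^bsub>M\<^esub>j\<in>{..<d}.
      (\<phi> ^^ j) x \<lhd>\<^bsub>M\<^esub> b (int j - int k) \<oplus>\<^bsub>M\<^esub> (\<phi> ^^ j) y \<lhd>\<^bsub>M\<^esub> b (int j - int k))"
    using x y
    by (subst shifted_eval_eq[OF _ b d], simp_all add: rmod_hom_add[OF funpow_hom] cl ract_add_left)
  also have "\<dots> = shifted_eval k x b \<oplus>\<^bsub>M\<^esub> shifted_eval k y b"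
    using cl by (simp add: shifted_eval_eq[OF x b d] shifted_eval_eq[OF y b d] ract_closed)
  finally show ?thesis .
qed

lemma shifted_eval_add_right:
  assumes x: "x \<in> carrier M" and b: "b \<in> laurent_carrier R" and c: "c \<in> laurent_carrier R"
    and bc: "b \<oplus>\<^bsub>laurent R\<^esub> c \<in> laurent_carrier R"
  shows "shifted_eval k x (b \<oplus>\<^bsub>laurent R\<^esub> c) = shifted_eval k x b \<oplus>\<^bsub>M\<^esub> shifted_eval k x c"
proof -
  obtain d where d: "\<And>j. j \<ge> d \<Longrightarrow> b (int j - int k) = \<zero>\<^bsub>R\<^esub>"
    using laurent_carrier_shift_bound[OF b, of k] by metis
  obtain e where e: "\<And>j. j \<ge> e \<Longrightarrow> c (int j - int k) = \<zero>\<^bsub>R\<^esub>"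
    using laurent_carrier_shift_bound[OF c, of k] by metis
  have de: "b (int j - int k) = \<zero>\<^bsub>R\<^esub>" "c (int j - int k) = \<zero>\<^bsub>R\<^esub>" if "j \<ge> max d e" for j
    using that d e by auto
  then have bc0: "(b \<oplus>\<^bsub>laurent R\<^esub> c) (int j - int k) = \<zero>\<^bsub>R\<^esub>" if "j \<ge> max d e" for j
    using that by (simp add: laurent_add)
  note cl = pow_closed[OF x] laurent_carrierD[OF b] laurent_carrierD[OF c]
  have "shifted_eval k x (b \<oplus>\<^bsub>laurent R\<^esub> c) = (\<Oplus>\<^bsub>M\<^esub>j\<in>{..<max d e}.
      (\<phi> ^^ j) x \<lhd>\<^bsub>M\<^esub> b (int j - int k) \<oplus>\<^bsub>M\<^esub> (\<phi> ^^ j) x \<lhd>\<^bsub>M\<^esub> c (int j - int k))"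
    by (subst shifted_eval_eq[OF x bc bc0], assumption) (simp add: laurent_add cl ract_add_right)
  also have "\<dots> = shifted_eval k x b \<oplus>\<^bsub>M\<^esub> shifted_eval k x c"
    using cl by (simp add: shifted_eval_eq[OF x b de(1)] shifted_eval_eq[OF x c de(2)] ract_closed
        del: max.bounded_iff)
  finally show ?thesis .
qed

text \<open>The last assumption says that \<open>b X^k\<close> is a polynomial \<open>q\<close>.
  Both sides are then the value of \<open>p q\<close> at \<open>x\<close>: one acts by
  \<open>p\<close> first and by \<open>q\<close> afterwards, the other multiplies first.\<close>

lemma shifted_eval_balanced:
  assumes x: "x \<in> carrier M" and p: "p \<in> up R" and b: "b \<in> laurent_carrier R"
    and pb: "laurent_of_poly R p \<otimes>\<^bsub>laurent R\<^esub> b \<in> laurent_carrier R"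
    and k: "\<And>i. i < - int k \<Longrightarrow> b i = \<zero>\<^bsub>R\<^esub>"
  shows "shifted_eval k (x \<lhd>\<^bsub>poly_module R M \<phi>\<^esub> p) b
    = shifted_eval k x (laurent_of_poly R p \<otimes>\<^bsub>laurent R\<^esub> b)"
proof -
  obtain e where e: "\<And>j. j \<ge> e \<Longrightarrow> b (int j - int k) = \<zero>\<^bsub>R\<^esub>"
    using laurent_carrier_shift_bound[OF b, of k] by metis
  obtain d where d: "\<And>i. i > d \<Longrightarrow> p i = \<zero>\<^bsub>R\<^esub>" using R.up_bound[OF p] by metis
  note pcl = R.up_closed[OF p] and bcl = laurent_carrierD[OF b] and xcl = pow_closed[OF x]
  \<comment> \<open>\<open>F l j\<close> is the part of coefficient \<open>l\<close> of the product
    that comes from \<open>p j\<close>, acting on \<open>\<phi>^l x\<close>.\<close>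
  define F where "F = (\<lambda>l j. (\<phi> ^^ l) x \<lhd>\<^bsub>M\<^esub> (p j \<otimes>\<^bsub>R\<^esub> b (int l - int j - int k)))"
  have Fcl: "F l j \<in> carrier M" for l j by (simp add: F_def ract_closed xcl pcl bcl)
  have mult: "(laurent_of_poly R p \<otimes>\<^bsub>laurent R\<^esub> b) i = (\<Oplus>\<^bsub>R\<^esub>j\<in>{..d}. p j \<otimes>\<^bsub>R\<^esub> b (i - int j))" for i
  proof -
    have supp: "{i. laurent_of_poly R p i \<noteq> \<zero>\<^bsub>R\<^esub>} \<subseteq> int ` {..d}"
    proof
      fix i assume "i \<in> {i. laurent_of_poly R p i \<noteq> \<zero>\<^bsub>R\<^esub>}"
      then have "\<not> i < 0" "p (nat i) \<noteq> \<zero>\<^bsub>R\<^esub>"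
        by (auto simp: R.laurent_of_poly_apply[OF p] split: if_splits)
      then show "i \<in> int ` {..d}"
        using d[of "nat i"] by (intro image_eqI[of _ _ "nat i"]) (auto intro: leI)
    qed
    have "(laurent_of_poly R p \<otimes>\<^bsub>laurent R\<^esub> b) i
        = (\<Oplus>\<^bsub>R\<^esub>j\<in>int ` {..d}. laurent_of_poly R p j \<otimes>\<^bsub>R\<^esub> b (i - j))"
      by (rule R.laurent_mult_eq_finsum[OF R.laurent_of_poly_closed[OF p] b _ supp]) simp
    also have "\<dots> = (\<Oplus>\<^bsub>R\<^esub>j\<in>{..d}. laurent_of_poly R p (int j) \<otimes>\<^bsub>R\<^esub> b (i - int j))"
      by (rule R.finsum_reindex)
        (auto simp: bcl laurent_carrierD[OF R.laurent_of_poly_closed[OF p]])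
    finally show ?thesis by (simp add: R.laurent_of_poly_apply[OF p])
  qed
  have "shifted_eval k (x \<lhd>\<^bsub>poly_module R M \<phi>\<^esub> p) b
      = (\<Oplus>\<^bsub>M\<^esub>i\<in>{..<e}. (\<phi> ^^ i) (x \<lhd>\<^bsub>poly_module R M \<phi>\<^esub> p) \<lhd>\<^bsub>M\<^esub> b (int i - int k))"
    by (rule shifted_eval_eq[OF poly_ract_closed[OF x p] b e])
  also have "\<dots> = (\<Oplus>\<^bsub>M\<^esub>i\<in>{..<e}. \<Oplus>\<^bsub>M\<^esub>j\<in>{..d}. F (i + j) j)"
  proof (rule M.finsum_cong')
    fix i
    let ?g = "\<lambda>y. (\<phi> ^^ i) y \<lhd>\<^bsub>M\<^esub> b (int i - int k)"
    have "?g (\<Oplus>\<^bsub>M\<^esub>j\<in>{..d}. (\<phi> ^^ j) x \<lhd>\<^bsub>M\<^esub> p j) = (\<Oplus>\<^bsub>M\<^esub>j\<in>{..d}. ?g ((\<phi> ^^ j) x \<lhd>\<^bsub>M\<^esub> p j))"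
      by (rule finsum_additive)
        (simp_all add: pow_closed ract_closed xcl pcl bcl rmod_hom_add[OF funpow_hom] ract_add_left)
    also have "\<dots> = (\<Oplus>\<^bsub>M\<^esub>j\<in>{..d}. F (i + j) j)"
      by (rule M.finsum_cong')
        (auto simp: F_def ract_closed pow_closed x pcl bcl rmod_hom_ract[OF funpow_hom] ract_assoc funpow_add)
    finally show "?g (x \<lhd>\<^bsub>poly_module R M \<phi>\<^esub> p) = (\<Oplus>\<^bsub>M\<^esub>j\<in>{..d}. F (i + j) j)"
      by (simp only: poly_ract_eq[OF x p d])
  qed (auto intro!: M.finsum_closed Fcl)
  also have "\<dots> = (\<Oplus>\<^bsub>M\<^esub>j\<in>{..d}. \<Oplus>\<^bsub>M\<^esub>i\<in>{..<e}. F (i + j) j)"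
    by (rule finsum_swap) (auto intro: Fcl)
  \<comment> \<open>The substitution \<open>l = i + j\<close> makes the range depend on
    \<open>j\<close>; extending it to \<open>{..<e + d}\<close> brings in only zero terms, below
    \<open>j\<close> by the assumption on \<open>k\<close> and from \<open>e + j\<close> on by the
    choice of \<open>e\<close>.\<close>
  also have "\<dots> = (\<Oplus>\<^bsub>M\<^esub>j\<in>{..d}. \<Oplus>\<^bsub>M\<^esub>l\<in>{..<e + d}. F l j)"
  proof (rule M.finsum_cong')
    fix j assume j: "j \<in> {..d}"
    have "(\<Oplus>\<^bsub>M\<^esub>i\<in>{..<e}. F (i + j) j) = (\<Oplus>\<^bsub>M\<^esub>l\<in>(\<lambda>i. i + j) ` {..<e}. F l j)"
      by (rule M.finsum_reindex[symmetric]) (auto intro: Fcl)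
    also have "\<dots> = (\<Oplus>\<^bsub>M\<^esub>l\<in>{..<e + d}. F l j)"
    proof (rule M.add.finprod_mono_neutral_cong_left)
      fix l assume l: "l \<in> {..<e + d} - (\<lambda>i. i + j) ` {..<e}"
      have "b (int l - int j - int k) = \<zero>\<^bsub>R\<^esub>"
      proof (cases "l < j")
        case True
        then show ?thesis by (intro k) linarith
      next
        case False
        then have "l = (l - j) + j" by simp
        with l have "l - j \<ge> e" by (metis DiffD2 image_eqI lessThan_iff not_less)
        then show ?thesis using e[of "l - j"] False by (simp add: of_nat_diff)
      qed
      then show "F l j = \<zero>\<^bsub>M\<^esub>" by (simp add: F_def ract_zero_right xcl pcl)
    qed (use j in \<open>auto intro: Fcl\<close>)
    finally show "(\<Oplus>\<^bsub>M\<^esub>i\<in>{..<e}. F (i + j) j) = (\<Oplus>\<^bsub>M\<^esub>l\<in>{..<e + d}. F l j)" .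
  qed (auto intro!: M.finsum_closed Fcl)
  also have "\<dots> = (\<Oplus>\<^bsub>M\<^esub>l\<in>{..<e + d}. \<Oplus>\<^bsub>M\<^esub>j\<in>{..d}. F l j)"
    by (rule finsum_swap) (auto intro: Fcl)
  also have "\<dots> = (\<Oplus>\<^bsub>M\<^esub>l\<in>{..<e + d}. (\<phi> ^^ l) x \<lhd>\<^bsub>M\<^esub> (laurent_of_poly R p \<otimes>\<^bsub>laurent R\<^esub> b) (int l - int k))"
  proof (rule M.finsum_cong')
    fix l
    show "(\<Oplus>\<^bsub>M\<^esub>j\<in>{..d}. F l j)
        = (\<phi> ^^ l) x \<lhd>\<^bsub>M\<^esub> (laurent_of_poly R p \<otimes>\<^bsub>laurent R\<^esub> b) (int l - int k)"
      unfolding mult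
      by (subst ract_finsum_right) (auto simp: F_def xcl pcl bcl algebra_simps)
  qed (auto simp: ract_closed xcl laurent_carrierD[OF pb])
  also have "\<dots> = shifted_eval k x (laurent_of_poly R p \<otimes>\<^bsub>laurent R\<^esub> b)"
  proof (rule shifted_eval_eq[OF x pb, symmetric])
    fix l assume l: "l \<ge> e + d"
    have "b (int l - int k - int j) = \<zero>\<^bsub>R\<^esub>" if "j \<le> d" for j
      using e[of "l - j"] l that by (simp add: of_nat_diff algebra_simps)
    then show "(laurent_of_poly R p \<otimes>\<^bsub>laurent R\<^esub> b) (int l - int k) = \<zero>\<^bsub>R\<^esub>"
      unfolding mult by (intro R.add.finprod_one_eqI) (simp add: pcl)
  qed
  finally show ?thesis .
qed

end

section \<open>The Laurent extension as a localization of \<open>M\<close>\<close>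

locale laurent_extension = right_module_endo R M \<phi> + P: right_module "laurent R" P
  for R :: "('a, 'k) ring_scheme" (structure) and M :: "('a, 'b) rmod" and \<phi> :: "'b \<Rightarrow> 'b"
    and P :: "(int \<Rightarrow> 'a, 'c) rmod" +
  fixes h
  assumes iso: "h \<in> rmod_hom (laurent R) P
      (base_change (UP R) (laurent R) (laurent_of_poly R) (poly_module R M \<phi>))"
    "bij_betw h (carrier P) (carrier
      (base_change (UP R) (laurent R) (laurent_of_poly R) (poly_module R M \<phi>)))"

sublocale laurent_extension \<subseteq>
  BC: base_change_copy "UP R" "laurent R" "laurent_of_poly R" "poly_module R M \<phi>" P h
proof (intro base_change_copy.intro base_change_setup.intro base_change_setup_axioms.intro
    base_change_copy_axioms.intro P.R.ring_axioms P.right_module_axioms iso)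
qed (simp_all add: carrier_poly_module poly_module_add R.carrier_UP carrier_laurent
    R.laurent_of_poly_closed poly_ract_closed)

context laurent_extension
begin

abbreviation \<psi> where "\<psi> y \<equiv> y \<lhd>\<^bsub>P\<^esub> laurent_X R"

definition embed where "embed x = BC.tensor x \<one>\<^bsub>laurent R\<^esub>"

lemma monom_closed: "r \<in> carrier R \<Longrightarrow> laurent_monom R r k \<in> carrier (laurent R)"
  by (simp add: carrier_laurent R.laurent_monom_closed)

lemma embed_closed: "x \<in> carrier M \<Longrightarrow> embed x \<in> carrier P"
  unfolding embed_def by (rule BC.tensor_closed) (simp_all add: carrier_poly_module)

lemma embed_poly_ract:
  assumes x: "x \<in> carrier M" and p: "p \<in> up R"
  shows "embed (x \<lhd>\<^bsub>poly_module R M \<phi>\<^esub> p) = embed x \<lhd>\<^bsub>P\<^esub> laurent_of_poly R p"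
proof -
  have l: "laurent_of_poly R p \<in> carrier (laurent R)"
    by (simp add: carrier_laurent R.laurent_of_poly_closed[OF p])
  show ?thesis
    unfolding embed_def using x p l
    by (simp add: BC.tensor_balanced BC.tensor_ract carrier_poly_module R.carrier_UP)
qed

lemma embed_ract:
  assumes "x \<in> carrier M" "r \<in> carrier R"
  shows "embed (x \<lhd>\<^bsub>M\<^esub> r) = embed x \<lhd>\<^bsub>P\<^esub> laurent_const R r"
  using embed_poly_ract[OF assms(1) R.up_monom_closed[OF assms(2)], of 0]
  by (simp add: poly_ract_monom assms R.laurent_of_up_monom laurent_const_eq_monom)

lemma embed_comm:
  assumes "x \<in> carrier M"
  shows "embed (\<phi> x) = \<psi> (embed x)"
  using embed_poly_ract[OF assms R.up_monom_closed[OF R.one_closed], of 1]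
  by (simp add: poly_ract_monom assms R.laurent_of_up_monom laurent_X_eq_monom ract_one
      rmod_hom_closed[OF endo])

lemma embed_add: "x \<in> carrier M \<Longrightarrow> y \<in> carrier M \<Longrightarrow> embed (x \<oplus>\<^bsub>M\<^esub> y) = embed x \<oplus>\<^bsub>P\<^esub> embed y"
  unfolding embed_def using BC.tensor_add_left[of x y "\<one>\<^bsub>laurent R\<^esub>"]
  by (simp add: carrier_poly_module poly_module_add)

lemma embed_pow: "x \<in> carrier M \<Longrightarrow> embed ((\<phi> ^^ k) x) = (\<psi> ^^ k) (embed x)"
  by (induction k) (simp_all add: embed_comm pow_closed)

lemma \<psi>_pow: "y \<in> carrier P \<Longrightarrow> (\<psi> ^^ k) y = y \<lhd>\<^bsub>P\<^esub> laurent_monom R \<one>\<^bsub>R\<^esub> (int k)"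
proof (induction k)
  case 0
  then show ?case using P.ract_one by (simp add: laurent_one_eq_monom)
next
  case (Suc k)
  then show ?case
    by (simp add: laurent_X_eq_monom monom_closed R.laurent_monom_mult_monom add.commute
        flip: P.ract_assoc)
qed

lemma \<psi>_inj: "inj_on \<psi> (carrier P)"
proof (rule inj_on_inverseI[of _ "\<lambda>y. y \<lhd>\<^bsub>P\<^esub> laurent_monom R \<one>\<^bsub>R\<^esub> (- 1)"])
  fix y assume "y \<in> carrier P"
  then show "\<psi> y \<lhd>\<^bsub>P\<^esub> laurent_monom R \<one>\<^bsub>R\<^esub> (- 1) = y"
    using P.ract_one
    by (simp add: laurent_X_eq_monom monom_closed R.laurent_monom_mult_monom laurent_one_eq_monom
        flip: P.ract_assoc)
qed

lemma right_module_restrict_scalars: "right_module R (restrict_scalars (laurent_const R) P)"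
proof -
  let ?N = "restrict_scalars (laurent_const R) P"
  have add: "laurent_monom R (r \<oplus>\<^bsub>R\<^esub> s) k = laurent_monom R r k \<oplus>\<^bsub>laurent R\<^esub> laurent_monom R s k"
    if "r \<in> carrier R" "s \<in> carrier R" for r s k
    using that by (auto simp: laurent_monom_def laurent_add)
  have "abelian_group ?N"
    by (rule abelian_groupI)
      (auto simp: restrict_scalars_def P.M.a_ac intro: bexI[of _ "\<ominus>\<^bsub>P\<^esub> _"] P.M.l_neg)
  then show ?thesis
    by (intro right_module.intro R.ring_axioms right_module_axioms.intro)
      (simp_all add: restrict_scalars_def laurent_const_eq_monom monom_closed P.ract_closed
        P.ract_add_left P.ract_add_right add P.ract_one R.laurent_monom_mult_monom
        flip: P.ract_assoc laurent_one_eq_monom)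
qed

text \<open>Although \<open>R\<close> need not be commutative, \<open>X\<close> commutes with the
  constants: both products are the same monomial. Hence the action of \<open>X\<close> is linear
  over \<open>R\<close>.\<close>

lemma \<psi>_hom:
  "\<psi> \<in> rmod_hom R (restrict_scalars (laurent_const R) P) (restrict_scalars (laurent_const R) P)"
  by (rule rmod_homI)
    (simp_all add: restrict_scalars_def laurent_const_eq_monom laurent_X_eq_monom monom_closed
      P.ract_closed P.ract_add_left R.laurent_monom_mult_monom flip: P.ract_assoc)

text \<open>A high power of \<open>X\<close> clears the negative exponents of \<open>b\<close> in
  \<open>x \<otimes> b\<close>, and a polynomial second factor moves to the first by balancing.
  Differences are treated with a common exponent.\<close>

lemma embed_exhaust:
  assumes "y \<in> carrier P"
  shows "\<exists>k. (\<psi> ^^ k) y \<in> embed ` carrier M"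
  using assms
proof (induction y rule: BC.tensor_induct)
  case zero
  have "embed \<zero>\<^bsub>M\<^esub> = \<zero>\<^bsub>P\<^esub>"
    using embed_add[of "\<zero>\<^bsub>M\<^esub>" "\<zero>\<^bsub>M\<^esub>"] embed_closed[of "\<zero>\<^bsub>M\<^esub>"] by simp
  then show ?case by (intro exI[of _ 0]) (auto intro!: image_eqI[of _ _ "\<zero>\<^bsub>M\<^esub>"])
next
  case (minus y z)
  then obtain k x l w where x: "x \<in> carrier M" "(\<psi> ^^ k) y = embed x"
    and w: "w \<in> carrier M" "(\<psi> ^^ l) z = embed w" by auto
  \<comment> \<open>Further applications of \<open>\<psi>\<close> stay in the image of
    \<open>embed\<close>, so both exponents can be raised to \<open>k + l\<close>.\<close>
  have "(\<psi> ^^ (k + l)) y = embed ((\<phi> ^^ l) x)"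
    using x by (simp add: add.commute[of k] funpow_add embed_pow)
  moreover have "(\<psi> ^^ (k + l)) z = embed ((\<phi> ^^ k) w)"
    using w by (simp add: funpow_add embed_pow)
  moreover have "embed (u \<ominus>\<^bsub>M\<^esub> v) = embed u \<ominus>\<^bsub>P\<^esub> embed v"
    if "u \<in> carrier M" "v \<in> carrier M" for u v
  proof -
    have "embed u = embed (u \<ominus>\<^bsub>M\<^esub> v) \<oplus>\<^bsub>P\<^esub> embed v"
      using that by (simp add: M.a_assoc a_minus_def M.l_neg flip: embed_add)
    then show ?thesis
      using that embed_closed by (simp add: a_minus_def P.M.a_assoc P.M.r_neg)
  qed
  moreover have "(\<psi> ^^ n) (y \<ominus>\<^bsub>P\<^esub> z) = (\<psi> ^^ n) y \<ominus>\<^bsub>P\<^esub> (\<psi> ^^ n) z" for n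
    using minus(1,2) by (simp add: \<psi>_pow monom_closed a_minus_def P.ract_add_left P.ract_minus_left)
  ultimately have "(\<psi> ^^ (k + l)) (y \<ominus>\<^bsub>P\<^esub> z) = embed ((\<phi> ^^ l) x \<ominus>\<^bsub>M\<^esub> (\<phi> ^^ k) w)"
    using x w pow_closed by simp
  then show ?case using x w pow_closed by (intro exI[of _ "k + l"]) auto
next
  case (tensor x b)
  then have x: "x \<in> carrier M" and b: "b \<in> laurent_carrier R"
    by (simp_all add: carrier_poly_module carrier_laurent)
  obtain k where k: "\<And>i. \<bar>i\<bar> > int k \<Longrightarrow> b i = \<zero>\<^bsub>R\<^esub>" using laurent_carrier_bound[OF b] by metis
  \<comment> \<open>\<open>p\<close> is \<open>b X^k\<close>: the support of \<open>b\<close> lies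
    between \<open>-k\<close> and \<open>k\<close>, so that of \<open>p\<close> lies between
    \<open>0\<close> and \<open>2 * k\<close>.\<close>
  define p where "p = (\<lambda>j::nat. b (int j - int k))"
  have p: "p \<in> up R"
    using k laurent_carrierD[OF b]
    by (auto simp: up_def p_def intro!: exI[of _ "2 * k"] bound.intro)
  have "(\<psi> ^^ k) (BC.tensor x b) = BC.tensor x (b \<otimes>\<^bsub>laurent R\<^esub> laurent_monom R \<one>\<^bsub>R\<^esub> (int k))"
    using tensor by (simp add: \<psi>_pow BC.tensor_closed BC.tensor_ract monom_closed)
  also have "b \<otimes>\<^bsub>laurent R\<^esub> laurent_monom R \<one>\<^bsub>R\<^esub> (int k) = laurent_of_poly R p"
    unfolding fun_eq_iff R.laurent_mult_monom[OF b R.one_closed] R.laurent_of_poly_apply[OF p]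
    using k by (auto simp: laurent_carrierD[OF b] p_def)
  also have "BC.tensor x (laurent_of_poly R p) = embed (x \<lhd>\<^bsub>poly_module R M \<phi>\<^esub> p)"
    using embed_poly_ract[OF x p] BC.tensor_ract[of x "\<one>\<^bsub>laurent R\<^esub>" "laurent_of_poly R p"]
      x R.laurent_of_poly_closed[OF p] P.R.one_closed P.R.l_one[of "laurent_of_poly R p"]
    by (simp add: embed_def carrier_poly_module carrier_laurent)
  finally show ?case using poly_ract_closed[OF x p] by blast
qed

text \<open>The truncated evaluations extend to homomorphisms from the free abelian group to
  \<open>M\<close>. Each relation is killed by all but finitely many of them, hence so is each
  element of \<open>H\<close>. If \<open>x \<otimes> 1\<close> vanishes, some evaluation sends it to
  0, and its value there is \<open>\<phi>^k x\<close>.\<close>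

lemma embed_kernel:
  assumes x: "x \<in> carrier M" and "embed x = \<zero>\<^bsub>P\<^esub>"
  shows "\<exists>k. (\<phi> ^^ k) x = \<zero>\<^bsub>M\<^esub>"
proof -
  let ?S = "carrier M \<times> laurent_carrier R"
  let ?G = "free_Abelian_group ?S"
  have S: "carrier (poly_module R M \<phi>) \<times> carrier (laurent R) = ?S"
    by (simp add: carrier_poly_module carrier_laurent)
  have "\<exists>E. E \<in> hom ?G (add_monoid M) \<and>
      (\<forall>z b. z \<in> carrier M \<longrightarrow> b \<in> laurent_carrier R \<longrightarrow> E (frag_of (z, b)) = shifted_eval k z b)" for k
    by (rule M.add.free_Abelian_group_universal[of "\<lambda>(z, b). shifted_eval k z b" ?S])
      (auto simp: shifted_eval_closed)
  then obtain E where E: "\<And>k. E k \<in> hom ?G (add_monoid M)"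
    and E_of: "\<And>k z b. z \<in> carrier M \<Longrightarrow> b \<in> laurent_carrier R
      \<Longrightarrow> E k (frag_of (z, b)) = shifted_eval k z b"
    by metis
  have E_closed: "f \<in> carrier ?G \<Longrightarrow> E k f \<in> carrier M" for k f
    using hom_in_carrier[OF E, of f k] by simp
  note diff_closed = BC.diff_closed[unfolded S] and frag_closed = BC.frag_of_closed[unfolded S, unfolded carrier_poly_module carrier_laurent]
  have cancel: "(y \<oplus>\<^bsub>M\<^esub> z) \<ominus>\<^bsub>M\<^esub> y \<ominus>\<^bsub>M\<^esub> z = \<zero>\<^bsub>M\<^esub>" if "y \<in> carrier M" "z \<in> carrier M" for y z
    using that by (simp add: a_minus_def M.a_assoc M.r_neg1 M.r_neg M.a_comm[of y z])
  have E_add: "E k (f + g) = E k f \<oplus>\<^bsub>M\<^esub> E k g" if "f \<in> carrier ?G" "g \<in> carrier ?G" for k f g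
    using hom_mult[OF E that] by simp
  have E_diff: "E k (f - g) = E k f \<ominus>\<^bsub>M\<^esub> E k g" if "f \<in> carrier ?G" "g \<in> carrier ?G" for k f g
  proof -
    have d: "f - g \<in> carrier ?G" using BC.diff_closed that by (simp only: S)
    have "E k f = E k (f - g) \<oplus>\<^bsub>M\<^esub> E k g" using E_add[OF d that(2)] by simp
    then show ?thesis
      using E_closed[OF d] E_closed[OF that(2)] by (simp add: a_minus_def M.a_assoc M.r_neg)
  qed
  \<comment> \<open>The threshold for \<open>k\<close> depends on the relation, so a fixed
    \<open>E k\<close> would not do; the eventual kernel is still a subgroup, as two thresholds have
    a maximum.\<close>
  define D where "D = {f \<in> carrier ?G. \<forall>\<^sub>F k in sequentially. E k f = \<zero>\<^bsub>M\<^esub>}"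
  have D_diff: "f - g \<in> D" if "f \<in> D" "g \<in> D" for f g
  proof -
    have "\<forall>\<^sub>F k in sequentially. E k (f - g) = \<zero>\<^bsub>M\<^esub>"
    proof -
      have fg: "f \<in> carrier ?G" "g \<in> carrier ?G" using that by (simp_all add: D_def)
      have "\<forall>\<^sub>F k in sequentially. E k f = \<zero>\<^bsub>M\<^esub>" "\<forall>\<^sub>F k in sequentially. E k g = \<zero>\<^bsub>M\<^esub>"
        using that by (simp_all add: D_def)
      then show ?thesis by eventually_elim (simp add: E_diff[OF fg] a_minus_def M.r_neg)
    qed
    then show ?thesis using that BC.diff_closed by (auto simp: D_def S)
  qed
  have "E k 0 = \<zero>\<^bsub>M\<^esub>" for k
    using E_diff[of 0 0 k] E_closed[of 0 k] by (simp add: a_minus_def M.r_neg)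
  then have D_0: "0 \<in> D" by (simp add: D_def)
  have "subgroup D ?G"
  proof (rule group.subgroupI[OF group_free_Abelian_group])
    show "inv\<^bsub>?G\<^esub> f \<in> D" if "f \<in> D" for f
      using D_diff[OF D_0 that] that by (simp add: D_def)
    show "f \<otimes>\<^bsub>?G\<^esub> g \<in> D" if "f \<in> D" "g \<in> D" for f g
      using D_diff[OF that(1) D_diff[OF D_0 that(2)]] by simp
  qed (use D_0 in \<open>auto simp: D_def\<close>)
  moreover have "BC.Rel \<subseteq> D"
  proof
    fix f assume f: "f \<in> BC.Rel"
    have "\<forall>\<^sub>F k in sequentially. E k f = \<zero>\<^bsub>M\<^esub>"
      using f
    proof (cases rule: BC.relation_cases)
      case (add_left a a' b)
      then have "E k f = shifted_eval k (a \<oplus>\<^bsub>M\<^esub> a') b \<ominus>\<^bsub>M\<^esub> shifted_eval k a b \<ominus>\<^bsub>M\<^esub> shifted_eval k a' b" for k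
        by (simp add: E_diff E_of diff_closed frag_closed carrier_poly_module carrier_laurent
            poly_module_add del: carrier_free_Abelian_group_iff)
      then show ?thesis
        using add_left by (simp add: shifted_eval_add_left shifted_eval_closed cancel
            carrier_poly_module carrier_laurent)
    next
      case (add_right a b b')
      then have "b \<oplus>\<^bsub>laurent R\<^esub> b' \<in> laurent_carrier R"
        using P.R.a_closed[of b b'] by (simp add: carrier_laurent)
      moreover from this add_right have
        "E k f = shifted_eval k a (b \<oplus>\<^bsub>laurent R\<^esub> b') \<ominus>\<^bsub>M\<^esub> shifted_eval k a b \<ominus>\<^bsub>M\<^esub> shifted_eval k a b'" for k
        by (simp add: E_diff E_of diff_closed frag_closed carrier_poly_module carrier_laurent
            del: carrier_free_Abelian_group_iff)
      ultimately show ?thesis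
        using add_right by (simp add: shifted_eval_add_right shifted_eval_closed cancel
            carrier_poly_module carrier_laurent)
    next
      case (balanced a p b)
      then have a: "a \<in> carrier M" and p: "p \<in> up R" and b: "b \<in> laurent_carrier R"
        by (simp_all add: carrier_poly_module R.carrier_UP carrier_laurent)
      have pb: "laurent_of_poly R p \<otimes>\<^bsub>laurent R\<^esub> b \<in> laurent_carrier R"
        using P.R.m_closed[of "laurent_of_poly R p" b] R.laurent_of_poly_closed[OF p] b
        by (simp add: carrier_laurent)
      have ap: "a \<lhd>\<^bsub>poly_module R M \<phi>\<^esub> p \<in> carrier M" by (rule poly_ract_closed[OF a p])
      obtain d where d: "\<And>i. \<bar>i\<bar> > int d \<Longrightarrow> b i = \<zero>\<^bsub>R\<^esub>" using laurent_carrier_bound[OF b] by metis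
      \<comment> \<open>For \<open>k \<ge> d\<close> the support of \<open>b\<close> starts at
        \<open>-k\<close> or later, so nothing is cut off and the balancing identity
        applies.\<close>
      show ?thesis
        using eventually_ge_at_top[of d]
      proof eventually_elim
        case (elim k)
        have "E k f = shifted_eval k (a \<lhd>\<^bsub>poly_module R M \<phi>\<^esub> p) b
            \<ominus>\<^bsub>M\<^esub> shifted_eval k a (laurent_of_poly R p \<otimes>\<^bsub>laurent R\<^esub> b)"
          unfolding balanced(4) using a ap b pb
          by (simp add: E_diff E_of frag_closed del: carrier_free_Abelian_group_iff)
        also have "\<dots> = \<zero>\<^bsub>M\<^esub>"
          using elim d shifted_eval_balanced[OF a p b pb, of k] shifted_eval_closed[OF a pb]
          by (simp add: a_minus_def M.r_neg)
        finally show ?case .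
      qed
    qed
    then show "f \<in> D" unfolding D_def using f BC.relations_subset[unfolded S] by blast
  qed
  ultimately have "BC.H \<subseteq> D"
    using group.generate_subgroup_incl[OF group_free_Abelian_group, of BC.Rel D ?S] by (simp add: S)
  moreover have "frag_of (x, \<one>\<^bsub>laurent R\<^esub>) \<in> BC.H"
    using assms BC.c_eq_zero_iff[of "frag_of (x, \<one>\<^bsub>laurent R\<^esub>)"]
    by (simp add: embed_def BC.tensor_def carrier_poly_module)
  ultimately obtain k where "E k (frag_of (x, \<one>\<^bsub>laurent R\<^esub>)) = \<zero>\<^bsub>M\<^esub>"
    unfolding D_def using eventually_happens'[OF sequentially_bot] by blast
  then have "shifted_eval k x \<one>\<^bsub>laurent R\<^esub> = \<zero>\<^bsub>M\<^esub>"
    using E_of[OF x] P.R.one_closed by (simp add: carrier_laurent)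
  then show ?thesis by (auto simp: shifted_eval_one[OF x])
qed

end

theorem corollary5p6:
  fixes R :: "('a, 'k) ring_scheme"
    and L :: "('a, 'u) rmod \<Rightarrow> ennreal"
    and M N :: "('a, 'u) rmod"
    and P :: "(int \<Rightarrow> 'a, 'u) rmod"
    and \<phi> \<psi> :: "'u \<Rightarrow> 'u"
  assumes "ring R"
    and "length_function R L"
    and "lFinX R L M \<phi>"
    and "is_laurent_extension R M \<phi> P"
    and "N = restrict_scalars (laurent_const R) P"
    and "\<psi> = (\<lambda>x. x \<lhd>\<^bsub>P\<^esub> laurent_X R)"
  shows "ent R L M \<phi> = ent R L N \<psi>"
proof -
  have M: "right_module R M" and \<phi>: "\<phi> \<in> rmod_hom R M M" and fin: "locally_L_finite R L M"
    using assms(3) by (simp_all add: lFinX_def)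
  obtain h where "right_module (laurent R) P"
    "h \<in> rmod_hom (laurent R) P (base_change (UP R) (laurent R) (laurent_of_poly R) (poly_module R M \<phi>))"
    "bij_betw h (carrier P)
      (carrier (base_change (UP R) (laurent R) (laurent_of_poly R) (poly_module R M \<phi>)))"
    using assms(4) by (auto simp: is_laurent_extension_def rmod_isomorphic_def)
  then interpret E: laurent_extension R M \<phi> P h
    using M \<phi> by (simp add: laurent_extension_def right_module_endo_def right_module_endo_axioms_def
        laurent_extension_axioms_def)
  \<comment> \<open>\<open>N\<close> and \<open>P\<close> share their additive structure, so facts
    about it transfer as they are; only the scalars change.\<close>
  have N_simps: "carrier N = carrier P" "\<zero>\<^bsub>N\<^esub> = \<zero>\<^bsub>P\<^esub>" "x \<oplus>\<^bsub>N\<^esub> y = x \<oplus>\<^bsub>P\<^esub> y"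
    "x \<lhd>\<^bsub>N\<^esub> r = x \<lhd>\<^bsub>P\<^esub> laurent_const R r" for x y r
    by (simp_all add: assms(5) restrict_scalars_def)
  have N: "right_module R N" using E.right_module_restrict_scalars by (simp add: assms(5))
  have \<psi>: "\<psi> \<in> rmod_hom R N N" using E.\<psi>_hom by (simp add: assms(5,6))
  \<comment> \<open>The map \<open>x \<mapsto> x \<otimes> 1\<close> exhibits \<open>N\<close> as
    the localization of \<open>M\<close> at \<open>\<phi>\<close>; what remains is the statement
    about localizations.\<close>
  interpret length_localization R L M N \<phi> \<psi> E.embed
  proof (intro length_localization.intro length_endo.intro length_fun.intro length_fun_axioms.intro
      right_module_endo.intro right_module_endo_axioms.intro length_localization_axioms.intro
      assms(1,2) M N \<phi> \<psi>)
    show "E.embed \<in> rmod_hom R M N"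
      by (rule rmod_homI) (simp_all add: N_simps E.embed_closed E.embed_add E.embed_ract)
    show "E.embed (\<phi> x) = \<psi> (E.embed x)" if "x \<in> carrier M" for x
      using E.embed_comm[OF that] by (simp add: assms(6))
    show "inj_on \<psi> (carrier N)" using E.\<psi>_inj by (simp add: N_simps assms(6))
    show "\<exists>k. (\<phi> ^^ k) x = \<zero>\<^bsub>M\<^esub>" if "x \<in> carrier M" "E.embed x = \<zero>\<^bsub>N\<^esub>" for x
      using E.embed_kernel that by (simp add: N_simps)
    show "\<exists>k. (\<psi> ^^ k) y \<in> E.embed ` carrier M" if "y \<in> carrier N" for y
      using E.embed_exhaust that by (simp add: N_simps assms(6))
  qed
  show ?thesis by (rule ent_eq[OF fin])
qed

end
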